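(* Let $p$ be a prime and let $1<r<\infty$. Let $\mathscr{K}:(0,\infty)\times(0,\infty)\to[0,\infty)$ be a measurable function satisfying $\mathscr{K}(\tau x,\tau y)=\tau^{-1}\mathscr{K}(x,y)$ for all $\tau,x,y>0$, and let $\mathscr{T}^p$ be the operator $$\mathscr{T}^pf(x)=\int_{\mathbb{Q}_p^*}\mathscr{K}(|x|_p,|y|_p)\,f(y)\,dy,\qquad x\in\mathbb{Q}_p^*.$$ If $$C_{p,r}:=(1-p^{-1})\sum_{j\in\mathbb{Z}}\mathscr{K}(1,p^j)\,p^{j(1-1/r)}<\infty,$$ then for any $f\in\mathrm{Ces}_r(\mathbb{Q}_p)$, $$\|\mathscr{T}^pf\|_{\mathrm{Ces}_r(\mathbb{Q}_p)}\le C_{p,r}\,\|f\|_{\mathrm{Ces}_r(\mathbb{Q}_p)}.$$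
   Context: $\mathbb{Q}_p$ is the field of $p$-adic numbers with absolute value $|\cdot|_p$ normalized by $|p|_p=p^{-1}$, and $\mathbb{Q}_p^*=\mathbb{Q}_p\setminus\{0\}$. $dx$ is the additive Haar measure on $\mathbb{Q}_p$ normalized so that $\{x:|x|_p\le 1\}$ has measure $1$. For $1\le r<\infty$, the $p$-adic Cesàro function space $\mathrm{Ces}_r(\mathbb{Q}_p)$ consists of all measurable functions $f$ on $\mathbb{Q}_p$ with $$\|f\|_{\mathrm{Ces}_r(\mathbb{Q}_p)}=\left(\int_{\mathbb{Q}_p}\left(\frac{1}{|x|_p}\int_{|y|_p\le|x|_p}|f(y)|\,dy\right)^r dx\right)^{1/r}<\infty.$$ *)

theory Defs
  imports "HOL-Analysis.Analysis" "Berlekamp_Zassenhaus.Finite_Field"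
begin

section \<open>The \<open>p\<close>-adic absolute value on the rationals\<close>

definition padic_abs_rat :: "nat \<Rightarrow> rat \<Rightarrow> real" where
  "padic_abs_rat p x = (if x = 0 then 0 else
     (case quotient_of x of (a, b) \<Rightarrow>
        real p powi (int (multiplicity (int p) b) - int (multiplicity (int p) a))))"

lemma padic_abs_rat_0 [simp]: "padic_abs_rat p 0 = 0"
  by (simp add: padic_abs_rat_def)

lemma padic_abs_rat_frac:
  assumes p: "prime p" and a: "a \<noteq> 0" and b: "b \<noteq> 0"
  shows "padic_abs_rat p (of_int a / of_int b) =
    real p powi (int (multiplicity (int p) b) - int (multiplicity (int p) a))"
proof -
  obtain c d where q: "quotient_of (of_int a / of_int b) = (c, d)"
    by fastforce
  have d: "d > 0" using quotient_of_denom_pos[OF q] .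
  have "of_int a / of_int b = (of_int c / of_int d :: rat)" using quotient_of_div[OF q] .
  hence "of_int (a * d) = (of_int (c * b) :: rat)" using b d by (simp add: field_simps)
  hence eq: "a * d = c * b" by linarith
  have c: "c \<noteq> 0" using eq a d by auto
  have pp: "prime_elem (int p)" using p by (simp add: prime_imp_prime_elem)
  have "multiplicity (int p) a + multiplicity (int p) d = multiplicity (int p) c + multiplicity (int p) b"
    using prime_elem_multiplicity_mult_distrib[OF pp] a b c d eq by (metis less_irrefl)
  hence "int (multiplicity (int p) d) - int (multiplicity (int p) c)
      = int (multiplicity (int p) b) - int (multiplicity (int p) a)" by linarith
  thus ?thesis using a b by (simp add: padic_abs_rat_def q)
qed

lemma rat_common_denominator:
  fixes x y :: rat
  obtains a b d where "d \<noteq> 0" "x = of_int a / of_int d" "y = of_int b / (of_int d :: rat)"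
proof -
  obtain a c where x: "quotient_of x = (a, c)" by fastforce
  obtain b d where y: "quotient_of y = (b, d)" by fastforce
  have "c > 0" "d > 0" using x y quotient_of_denom_pos by auto
  thus ?thesis using quotient_of_div[OF x] quotient_of_div[OF y]
    by (intro that[of "c * d" "a * d" "b * c"]) (auto simp: field_simps)
qed

lemma padic_abs_rat_eq_0_iff: "prime p \<Longrightarrow> padic_abs_rat p x = 0 \<longleftrightarrow> x = 0"
  by (auto simp: padic_abs_rat_def prime_gt_0_nat split: prod.splits)

lemma padic_abs_rat_nonneg: "padic_abs_rat p x \<ge> 0"
  by (auto simp: padic_abs_rat_def split: prod.splits)

lemma padic_abs_rat_1 [simp]: "prime p \<Longrightarrow> padic_abs_rat p 1 = 1"
  using padic_abs_rat_frac[of p 1 1] by simp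

lemma padic_abs_rat_mult:
  assumes p: "prime p"
  shows "padic_abs_rat p (x * y) = padic_abs_rat p x * padic_abs_rat p y"
proof (cases "x = 0 \<or> y = 0")
  case False
  obtain a b d where *: "d \<noteq> 0" "x = of_int a / of_int d" "y = of_int b / of_int d"
    by (rule rat_common_denominator)
  have ab: "a \<noteq> 0" "b \<noteq> 0" using * False by auto
  have pp: "prime_elem (int p)" using p by (simp add: prime_imp_prime_elem)
  let ?v = "\<lambda>a. int (multiplicity (int p) a)"
  have xy: "x * y = of_int (a * b) / of_int (d * d)" by (simp add: *)
  have v: "padic_abs_rat p x = real p powi (?v d - ?v a)"
    "padic_abs_rat p y = real p powi (?v d - ?v b)"
    "padic_abs_rat p (x * y) = real p powi (?v (d * d) - ?v (a * b))"
    unfolding xy unfolding *(2,3) using ab *(1) by (intro padic_abs_rat_frac p; simp)+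
  have "?v (d * d) - ?v (a * b) = (?v d - ?v a) + (?v d - ?v b)"
    using prime_elem_multiplicity_mult_distrib[OF pp] ab *(1) by simp
  moreover have "real p \<noteq> 0" using p by (auto simp: prime_gt_0_nat)
  ultimately show ?thesis unfolding v by (simp only: power_int_add simp_thms)
qed auto

lemma padic_abs_rat_minus:
  assumes p: "prime p" shows "padic_abs_rat p (- x) = padic_abs_rat p x"
proof -
  have "padic_abs_rat p (-1) = 1"
    using padic_abs_rat_frac[OF p, of "-1" 1] multiplicity_unit_right[of "-1::int" "int p"]
    by simp
  thus ?thesis using padic_abs_rat_mult[OF p, of "-1" x] by simp
qed

lemma padic_abs_rat_diff_commute:
  "prime p \<Longrightarrow> padic_abs_rat p (x - y) = padic_abs_rat p (y - x)"
  using padic_abs_rat_minus[of p "x - y"] by simp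

lemma padic_abs_rat_ultrametric:
  assumes p: "prime p"
  shows "padic_abs_rat p (x + y) \<le> max (padic_abs_rat p x) (padic_abs_rat p y)"
proof (cases "x = 0 \<or> y = 0 \<or> x + y = 0")
  case True
  thus ?thesis using padic_abs_rat_nonneg[of p x] by (auto simp: max.coboundedI1)
next
  case False
  obtain a b d where *: "d \<noteq> 0" "x = of_int a / of_int d" "y = of_int b / of_int d"
    by (rule rat_common_denominator)
  have xy: "x + y = of_int (a + b) / of_int d" using * by (simp add: add_divide_distrib)
  have ab: "a \<noteq> 0" "b \<noteq> 0" "a + b \<noteq> 0" using * False xy by auto
  let ?v = "\<lambda>a. multiplicity (int p) a"
  have p1: "p > 1" using p prime_gt_1_nat by blast
  have "int p ^ min (?v a) (?v b) dvd a + b"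
    by (intro dvd_add multiplicity_dvd') auto
  hence "min (?v a) (?v b) \<le> ?v (a + b)"
    using ab p1 by (intro multiplicity_geI) auto
  hence "real p powi (int (?v d) - int (?v (a + b))) \<le>
    real p powi (int (?v d) - int (min (?v a) (?v b)))"
    using p1 by (intro power_int_increasing) auto
  also have "\<dots> \<le> max (real p powi (int (?v d) - int (?v a))) (real p powi (int (?v d) - int (?v b)))"
    by (auto simp: min_def)
  finally show ?thesis
    unfolding xy padic_abs_rat_frac[OF p ab(3) *(1)] unfolding *(2,3)
      padic_abs_rat_frac[OF p ab(1) *(1)] padic_abs_rat_frac[OF p ab(2) *(1)] .
qed

lemma padic_abs_rat_triangle:
  "prime p \<Longrightarrow> padic_abs_rat p (x + y) \<le> padic_abs_rat p x + padic_abs_rat p y"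
  using padic_abs_rat_ultrametric[of p x y] padic_abs_rat_nonneg[of p x]
    padic_abs_rat_nonneg[of p y] by linarith

lemma padic_abs_rat_triangle':
  "prime p \<Longrightarrow> \<bar>padic_abs_rat p x - padic_abs_rat p y\<bar> \<le> padic_abs_rat p (x - y)"
  using padic_abs_rat_triangle[of p "x - y" y] padic_abs_rat_triangle[of p "y - x" x]
    padic_abs_rat_diff_commute[of p x y] by auto

lemma padic_abs_rat_inverse:
  assumes "prime p" shows "padic_abs_rat p (inverse x) = inverse (padic_abs_rat p x)"
proof (cases "x = 0")
  case False
  thus ?thesis using padic_abs_rat_mult[OF assms, of x "inverse x"] assms
    by (simp add: padic_abs_rat_eq_0_iff field_simps)
qed simp

lemma padic_abs_rat_inverse_diff:
  assumes p: "prime p" and "a \<noteq> 0" "b \<noteq> 0"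
  shows "padic_abs_rat p (inverse a - inverse b) =
    padic_abs_rat p (a - b) / (padic_abs_rat p a * padic_abs_rat p b)"
proof -
  have "inverse a - inverse b = (b - a) * (inverse a * inverse b)"
    using assms by (simp add: field_simps)
  thus ?thesis
    by (simp only: padic_abs_rat_mult[OF p] padic_abs_rat_inverse[OF p] divide_inverse
        inverse_mult_distrib padic_abs_rat_diff_commute[OF p, of b a])
qed


section \<open>The field of \<open>p\<close>-adic numbers as the completion of the rationals\<close>

definition padic_cauchy :: "nat \<Rightarrow> (nat \<Rightarrow> rat) \<Rightarrow> bool" where
  "padic_cauchy p X \<longleftrightarrow>
     (\<forall>e>0. \<exists>N. \<forall>m\<ge>N. \<forall>n\<ge>N. padic_abs_rat p (X m - X n) < e)"

definition padic_rel :: "nat \<Rightarrow> (nat \<Rightarrow> rat) \<Rightarrow> (nat \<Rightarrow> rat) \<Rightarrow> bool" where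
  "padic_rel p X Y \<longleftrightarrow> padic_cauchy p X \<and> padic_cauchy p Y \<and>
     (\<lambda>n. padic_abs_rat p (X n - Y n)) \<longlonglongrightarrow> 0"

lemma padic_cauchyD:
  "padic_cauchy p X \<Longrightarrow> e > 0 \<Longrightarrow> \<exists>N. \<forall>m\<ge>N. \<forall>n\<ge>N. padic_abs_rat p (X m - X n) < e"
  by (simp add: padic_cauchy_def)

lemma padic_cauchy_const [simp]: "padic_cauchy p (\<lambda>n. c)"
  by (simp add: padic_cauchy_def)

lemma padic_cauchy_convergent:
  assumes p: "prime p" and X: "padic_cauchy p X"
  shows "convergent (\<lambda>n. padic_abs_rat p (X n))"
proof -
  have "Cauchy (\<lambda>n. padic_abs_rat p (X n))"
  proof (rule metric_CauchyI)
    fix e :: real assume "e > 0"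
    then obtain N where "\<forall>m\<ge>N. \<forall>n\<ge>N. padic_abs_rat p (X m - X n) < e"
      using padic_cauchyD[OF X] by blast
    thus "\<exists>N. \<forall>m\<ge>N. \<forall>n\<ge>N. dist (padic_abs_rat p (X m)) (padic_abs_rat p (X n)) < e"
      unfolding dist_real_def by (intro exI[of _ N] allI impI le_less_trans[OF padic_abs_rat_triangle'[OF p]]) auto
  qed
  thus ?thesis by (simp add: Cauchy_convergent_iff)
qed

lemma padic_cauchy_bounded:
  assumes p: "prime p" and X: "padic_cauchy p X"
  obtains B where "B > 0" "\<And>n. padic_abs_rat p (X n) \<le> B"
proof -
  from convergent_imp_Bseq[OF padic_cauchy_convergent[OF assms]]
  obtain B where "B > 0" "\<forall>n. norm (padic_abs_rat p (X n)) \<le> B" by (rule BseqE)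
  thus ?thesis by (intro that[of B]) (simp_all add: padic_abs_rat_nonneg)
qed

lemma padic_null_dominated:
  assumes "X \<longlonglongrightarrow> 0" "\<And>n. padic_abs_rat p (Y n) \<le> X n"
  shows "(\<lambda>n. padic_abs_rat p (Y n)) \<longlonglongrightarrow> 0"
  by (rule tendsto_sandwich[of "\<lambda>_. 0" _ _ X]) (use assms padic_abs_rat_nonneg in auto)

lemma padic_cauchy_add:
  assumes p: "prime p" and X: "padic_cauchy p X" and Y: "padic_cauchy p Y"
  shows "padic_cauchy p (\<lambda>n. X n + Y n)"
  unfolding padic_cauchy_def
proof (intro allI impI)
  fix e :: real assume e: "e > 0"
  obtain M where M: "\<And>m n. m \<ge> M \<Longrightarrow> n \<ge> M \<Longrightarrow> padic_abs_rat p (X m - X n) < e"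
    using padic_cauchyD[OF X e] by blast
  obtain N where N: "\<And>m n. m \<ge> N \<Longrightarrow> n \<ge> N \<Longrightarrow> padic_abs_rat p (Y m - Y n) < e"
    using padic_cauchyD[OF Y e] by blast
  have "padic_abs_rat p ((X m + Y m) - (X n + Y n)) < e" if "m \<ge> max M N" "n \<ge> max M N" for m n
    using padic_abs_rat_ultrametric[OF p, of "X m - X n" "Y m - Y n"] M[of m n] N[of m n] that
    by (simp add: algebra_simps)
  thus "\<exists>N. \<forall>m\<ge>N. \<forall>n\<ge>N. padic_abs_rat p ((X m + Y m) - (X n + Y n)) < e"
    by (intro exI[of _ "max M N"] allI impI)
qed

lemma padic_cauchy_minus:
  "prime p \<Longrightarrow> padic_cauchy p X \<Longrightarrow> padic_cauchy p (\<lambda>n. - X n)"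
  unfolding padic_cauchy_def
  by (metis (no_types, lifting) minus_diff_minus padic_abs_rat_minus)

lemma padic_cauchy_mult:
  assumes p: "prime p" and X: "padic_cauchy p X" and Y: "padic_cauchy p Y"
  shows "padic_cauchy p (\<lambda>n. X n * Y n)"
  unfolding padic_cauchy_def
proof (intro allI impI)
  fix e :: real assume e: "e > 0"
  obtain A where A: "A > 0" "\<And>n. padic_abs_rat p (X n) \<le> A"
    using padic_cauchy_bounded[OF p X] by blast
  obtain B where B: "B > 0" "\<And>n. padic_abs_rat p (Y n) \<le> B"
    using padic_cauchy_bounded[OF p Y] by blast
  obtain M where M: "\<And>m n. m \<ge> M \<Longrightarrow> n \<ge> M \<Longrightarrow> padic_abs_rat p (X m - X n) < e / B"
    using padic_cauchyD[OF X, of "e / B"] e B by auto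
  obtain N where N: "\<And>m n. m \<ge> N \<Longrightarrow> n \<ge> N \<Longrightarrow> padic_abs_rat p (Y m - Y n) < e / A"
    using padic_cauchyD[OF Y, of "e / A"] e A by auto
  have "padic_abs_rat p (X m * Y m - X n * Y n) < e" if mn: "m \<ge> max M N" "n \<ge> max M N" for m n
  proof -
    have "padic_abs_rat p (X m - X n) * padic_abs_rat p (Y n) \<le> padic_abs_rat p (X m - X n) * B"
      using B by (intro mult_left_mono padic_abs_rat_nonneg) auto
    also have "\<dots> < e" using M[of m n] mn B by (simp add: field_simps)
    finally have 1: "padic_abs_rat p ((X m - X n) * Y n) < e" by (simp add: padic_abs_rat_mult[OF p])
    have "padic_abs_rat p (X m) * padic_abs_rat p (Y m - Y n) \<le> A * padic_abs_rat p (Y m - Y n)"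
      using A by (intro mult_right_mono padic_abs_rat_nonneg) auto
    also have "\<dots> < e" using N[of m n] mn A by (simp add: field_simps)
    finally have 2: "padic_abs_rat p (X m * (Y m - Y n)) < e" by (simp add: padic_abs_rat_mult[OF p])
    have "X m * Y m - X n * Y n = (X m - X n) * Y n + X m * (Y m - Y n)"
      by (simp add: algebra_simps)
    thus ?thesis using padic_abs_rat_ultrametric[OF p, of "(X m - X n) * Y n" "X m * (Y m - Y n)"] 1 2
      by simp
  qed
  thus "\<exists>N. \<forall>m\<ge>N. \<forall>n\<ge>N. padic_abs_rat p (X m * Y m - X n * Y n) < e"
    by (intro exI[of _ "max M N"] allI impI)
qed

lemma padic_cauchy_not_null:
  assumes p: "prime p" and X: "padic_cauchy p X"
    and nn: "\<not> (\<lambda>n. padic_abs_rat p (X n)) \<longlonglongrightarrow> 0"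
  obtains c N where "c > 0" "\<And>n. n \<ge> N \<Longrightarrow> padic_abs_rat p (X n) > c"
proof -
  obtain L where L: "(\<lambda>n. padic_abs_rat p (X n)) \<longlonglongrightarrow> L"
    using padic_cauchy_convergent[OF p X] by (auto simp: convergent_def)
  have "L \<ge> 0" using L padic_abs_rat_nonneg by (intro LIMSEQ_le_const[OF L]) auto
  with nn L have "L > 0" by (cases "L = 0") auto
  hence "eventually (\<lambda>n. padic_abs_rat p (X n) > L / 2) sequentially"
    by (intro order_tendstoD(1)[OF L]) auto
  thus ?thesis using that[of "L / 2"] \<open>L > 0\<close> by (auto simp: eventually_sequentially)
qed

lemma padic_cauchy_inverse:
  assumes p: "prime p" and X: "padic_cauchy p X"
    and nn: "\<not> (\<lambda>n. padic_abs_rat p (X n)) \<longlonglongrightarrow> 0"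
  shows "padic_cauchy p (\<lambda>n. inverse (X n))"
  unfolding padic_cauchy_def
proof (intro allI impI)
  fix e :: real assume e: "e > 0"
  obtain c M where c: "c > 0" "\<And>n. n \<ge> M \<Longrightarrow> padic_abs_rat p (X n) > c"
    using padic_cauchy_not_null[OF assms] by blast
  obtain N where N: "\<And>m n. m \<ge> N \<Longrightarrow> n \<ge> N \<Longrightarrow> padic_abs_rat p (X m - X n) < e * (c * c)"
    using padic_cauchyD[OF X, of "e * (c * c)"] e c by auto
  have "padic_abs_rat p (inverse (X m) - inverse (X n)) < e" if mn: "m \<ge> max M N" "n \<ge> max M N" for m n
  proof -
    have cm: "padic_abs_rat p (X m) > c" "padic_abs_rat p (X n) > c" using c mn by auto
    hence nz: "X m \<noteq> 0" "X n \<noteq> 0" using c by auto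
    hence "padic_abs_rat p (inverse (X m) - inverse (X n)) =
        padic_abs_rat p (X m - X n) / (padic_abs_rat p (X m) * padic_abs_rat p (X n))"
      by (rule padic_abs_rat_inverse_diff[OF p])
    also have "\<dots> \<le> padic_abs_rat p (X m - X n) / (c * c)"
      using cm c by (intro divide_left_mono mult_mono mult_pos_pos padic_abs_rat_nonneg) auto
    also have "\<dots> < e" using N[of m n] mn c by (simp add: field_simps)
    finally show ?thesis .
  qed
  thus "\<exists>N. \<forall>m\<ge>N. \<forall>n\<ge>N. padic_abs_rat p (inverse (X m) - inverse (X n)) < e"
    by (intro exI[of _ "max M N"] allI impI)
qed

lemma padic_rel_refl: "padic_rel p X X \<longleftrightarrow> padic_cauchy p X"
  by (simp add: padic_rel_def)

lemma padic_rel_eqI: "padic_cauchy p X \<Longrightarrow> (\<And>n. X n = Y n) \<Longrightarrow> padic_rel p X Y"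
  using ext[of X Y] by (metis padic_rel_refl)

lemma padic_rel_symp: "prime p \<Longrightarrow> symp (padic_rel p)"
  by (rule sympI) (auto simp: padic_rel_def padic_abs_rat_diff_commute)

lemma padic_rel_transp: 
  assumes p: "prime p" shows "transp (padic_rel p)"
proof (rule transpI)
  fix X Y Z assume "padic_rel p X Y" "padic_rel p Y Z"
  moreover from this have "(\<lambda>n. padic_abs_rat p (X n - Y n) + padic_abs_rat p (Y n - Z n)) \<longlonglongrightarrow> 0 + 0"
    by (intro tendsto_add) (auto simp: padic_rel_def)
  moreover have "padic_abs_rat p (X n - Z n) \<le> padic_abs_rat p (X n - Y n) + padic_abs_rat p (Y n - Z n)" for n
    using padic_abs_rat_triangle[OF p, of "X n - Y n" "Y n - Z n"] by simp
  ultimately show "padic_rel p X Z"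
    unfolding padic_rel_def by (auto intro: padic_null_dominated)
qed

lemma padic_rel_part_equivp: "prime p \<Longrightarrow> part_equivp (padic_rel p)"
  by (intro part_equivpI padic_rel_symp padic_rel_transp)
     (auto intro!: exI[of _ "\<lambda>_. 0"] simp: padic_rel_refl)

lemma padic_rel_limit:
  assumes p: "prime p" and R: "padic_rel p X Y"
  shows "lim (\<lambda>n. padic_abs_rat p (X n)) = lim (\<lambda>n. padic_abs_rat p (Y n))"
proof -
  obtain L where L: "(\<lambda>n. padic_abs_rat p (Y n)) \<longlonglongrightarrow> L"
    using padic_cauchy_convergent[OF p] R by (auto simp: convergent_def padic_rel_def)
  have "(\<lambda>n. padic_abs_rat p (X n) - padic_abs_rat p (Y n)) \<longlonglongrightarrow> 0"
    by (rule Lim_null_comparison[of _ "\<lambda>n. padic_abs_rat p (X n - Y n)"])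
       (use R padic_abs_rat_triangle'[OF p] in \<open>auto simp: padic_rel_def\<close>)
  from tendsto_add[OF this L] have "(\<lambda>n. padic_abs_rat p (X n)) \<longlonglongrightarrow> L" by simp
  thus ?thesis using L by (simp add: limI)
qed

text \<open>The prime \<open>p\<close> enters as the cardinality of the type \<open>'p\<close>; the elements of the type
  \<open>'p padic\<close> are the classes of Cauchy sequences of rationals modulo null sequences.\<close>

typedef (overloaded) 'p padic =
  "{{Y. padic_rel CARD('p) X Y} | X. padic_cauchy CARD('p::prime_card) X}"
  using padic_cauchy_const by blast

definition abs_padic :: "(nat \<Rightarrow> rat) \<Rightarrow> 'p::prime_card padic" where
  "abs_padic X = Abs_padic {Y. padic_rel CARD('p) X Y}"

definition rep_padic :: "'p::prime_card padic \<Rightarrow> nat \<Rightarrow> rat" where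
  "rep_padic x = (SOME X. X \<in> Rep_padic x)"

definition cr_padic :: "(nat \<Rightarrow> rat) \<Rightarrow> 'p::prime_card padic \<Rightarrow> bool" where
  "cr_padic X x \<longleftrightarrow> padic_rel CARD('p) X X \<and> abs_padic X = x"

lemma Quotient_padic:
  "Quotient (padic_rel CARD('p::prime_card)) abs_padic rep_padic (cr_padic :: _ \<Rightarrow> 'p padic \<Rightarrow> bool)"
proof -
  let ?R = "padic_rel CARD('p)"
  have sym: "?R X Y \<Longrightarrow> ?R Y X" for X Y
    using padic_rel_symp[OF prime_card] by (rule sympD)
  have trans: "?R X Y \<Longrightarrow> ?R Y Z \<Longrightarrow> ?R X Z" for X Y Z
    using padic_rel_transp[OF prime_card] by (rule transpD)
  have rep: "?R (rep_padic x) (rep_padic x) \<and> abs_padic (rep_padic x) = x" for x :: "'p padic"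
  proof -
    obtain X where X: "Rep_padic x = {Y. ?R X Y}" "padic_cauchy CARD('p) X"
      using Rep_padic[of x] by auto
    have "X \<in> Rep_padic x" using X by (simp add: padic_rel_refl)
    hence "rep_padic x \<in> Rep_padic x" unfolding rep_padic_def using someI[of "\<lambda>X. X \<in> Rep_padic x"] by blast
    hence R: "?R X (rep_padic x)" using X by simp
    have "{Y. ?R (rep_padic x) Y} = {Y. ?R X Y}" using R sym trans by blast
    hence "abs_padic (rep_padic x) = x"
      unfolding abs_padic_def using X(1) by (metis Rep_padic_inverse)
    thus ?thesis using R sym trans by blast
  qed
  have eq: "?R X Y \<longleftrightarrow> ?R X X \<and> ?R Y Y \<and> abs_padic X = (abs_padic Y :: 'p padic)" for X Y
  proof
    assume R: "?R X Y"
    have "{Z. ?R X Z} = {Z. ?R Y Z}" using R sym trans by blast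
    thus "?R X X \<and> ?R Y Y \<and> abs_padic X = (abs_padic Y :: 'p padic)"
      using R sym trans unfolding abs_padic_def by metis
  next
    assume *: "?R X X \<and> ?R Y Y \<and> abs_padic X = (abs_padic Y :: 'p padic)"
    have mem: "{Z. ?R W Z} \<in> {{Y. ?R X Y} | X. padic_cauchy CARD('p) X}" if "?R W W" for W
      using that unfolding padic_rel_refl by blast
    have RX: "?R X X" and RY: "?R Y Y" using * by simp_all
    have "Abs_padic {Z. ?R X Z} = (Abs_padic {Z. ?R Y Z} :: 'p padic)"
      using * by (simp only: abs_padic_def)
    hence "{Z. ?R X Z} = {Z. ?R Y Z}" using Abs_padic_inject[OF mem[OF RX] mem[OF RY]] by simp
    thus "?R X Y" using RY by blast
  qed
  show ?thesis
    unfolding Quotient_def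
  proof (intro conjI allI)
    show "?R X Y = (?R X X \<and> ?R Y Y \<and> abs_padic X = (abs_padic Y :: 'p padic))" for X Y
      by (rule eq)
  qed (use rep in \<open>auto simp: cr_padic_def fun_eq_iff\<close>)
qed

setup_lifting Quotient_padic

instantiation padic :: (prime_card) field
begin

lift_definition zero_padic :: "'a padic" is "\<lambda>n. 0"
  by (simp add: padic_rel_refl)

lift_definition one_padic :: "'a padic" is "\<lambda>n. 1"
  by (simp add: padic_rel_refl)

lift_definition plus_padic :: "'a padic \<Rightarrow> 'a padic \<Rightarrow> 'a padic" is "\<lambda>X Y n. X n + Y n"
proof -
  fix X X' Y Y' assume R: "padic_rel CARD('a) X X'" "padic_rel CARD('a) Y Y'"
  have "(\<lambda>n. padic_abs_rat CARD('a) (X n - X' n) + padic_abs_rat CARD('a) (Y n - Y' n)) \<longlonglongrightarrow> 0 + 0"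
    using R by (intro tendsto_add) (auto simp: padic_rel_def)
  moreover have "padic_abs_rat CARD('a) ((X n + Y n) - (X' n + Y' n)) \<le>
      padic_abs_rat CARD('a) (X n - X' n) + padic_abs_rat CARD('a) (Y n - Y' n)" for n
    using padic_abs_rat_triangle[OF prime_card, where 'a1='a, of "X n - X' n" "Y n - Y' n"]
    by (simp add: algebra_simps)
  ultimately show "padic_rel CARD('a) (\<lambda>n. X n + Y n) (\<lambda>n. X' n + Y' n)"
    using R unfolding padic_rel_def
    by (auto intro: padic_null_dominated padic_cauchy_add prime_card)
qed

lift_definition uminus_padic :: "'a padic \<Rightarrow> 'a padic" is "\<lambda>X n. - X n"
proof -
  fix X X' assume R: "padic_rel CARD('a) X X'"
  have "padic_abs_rat CARD('a) (- X n - - X' n) = padic_abs_rat CARD('a) (X n - X' n)" for n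
    using padic_abs_rat_minus[OF prime_card, where 'a1='a, of "X n - X' n"] by simp
  thus "padic_rel CARD('a) (\<lambda>n. - X n) (\<lambda>n. - X' n)"
    using R unfolding padic_rel_def by (auto intro!: padic_cauchy_minus prime_card)
qed

lift_definition times_padic :: "'a padic \<Rightarrow> 'a padic \<Rightarrow> 'a padic" is "\<lambda>X Y n. X n * Y n"
proof -
  fix X X' Y Y' assume R: "padic_rel CARD('a) X X'" "padic_rel CARD('a) Y Y'"
  let ?v = "padic_abs_rat CARD('a)"
  note p = prime_card[where 'a='a]
  have c: "padic_cauchy CARD('a) X" "padic_cauchy CARD('a) X'"
    "padic_cauchy CARD('a) Y" "padic_cauchy CARD('a) Y'" using R by (auto simp: padic_rel_def)
  obtain A where A: "A > 0" "\<And>n. ?v (X n) \<le> A" using padic_cauchy_bounded[OF p c(1)] by blast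
  obtain B where B: "B > 0" "\<And>n. ?v (Y' n) \<le> B" using padic_cauchy_bounded[OF p c(4)] by blast
  have "(\<lambda>n. A * ?v (Y n - Y' n) + ?v (X n - X' n) * B) \<longlonglongrightarrow> A * 0 + 0 * B"
    using R by (intro tendsto_intros) (auto simp: padic_rel_def)
  moreover have "?v (X n * Y n - X' n * Y' n) \<le> A * ?v (Y n - Y' n) + ?v (X n - X' n) * B" for n
  proof -
    have "?v (X n * Y n - X' n * Y' n) = ?v (X n * (Y n - Y' n) + (X n - X' n) * Y' n)"
      by (simp add: algebra_simps)
    also have "\<dots> \<le> ?v (X n) * ?v (Y n - Y' n) + ?v (X n - X' n) * ?v (Y' n)"
      using padic_abs_rat_triangle[OF p] by (metis padic_abs_rat_mult[OF p])
    also have "\<dots> \<le> A * ?v (Y n - Y' n) + ?v (X n - X' n) * B"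
      using A B by (intro add_mono mult_right_mono mult_left_mono padic_abs_rat_nonneg) auto
    finally show ?thesis .
  qed
  ultimately show "padic_rel CARD('a) (\<lambda>n. X n * Y n) (\<lambda>n. X' n * Y' n)"
    using c unfolding padic_rel_def
    by (auto intro: padic_null_dominated padic_cauchy_mult p)
qed

lift_definition inverse_padic :: "'a padic \<Rightarrow> 'a padic" is
  "\<lambda>X. if (\<lambda>n. padic_abs_rat CARD('a) (X n)) \<longlonglongrightarrow> 0 then (\<lambda>n. 0) else (\<lambda>n. inverse (X n))"
proof -
  fix X Y assume R: "padic_rel CARD('a) X Y"
  let ?v = "padic_abs_rat CARD('a)"
  note p = prime_card[where 'a='a]
  have c: "padic_cauchy CARD('a) X" "padic_cauchy CARD('a) Y" using R by (auto simp: padic_rel_def)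
  have null: "(\<lambda>n. ?v (X n)) \<longlonglongrightarrow> 0 \<longleftrightarrow> (\<lambda>n. ?v (Y n)) \<longlonglongrightarrow> 0"
    using padic_rel_limit[OF p R] padic_cauchy_convergent[OF p c(1)]
      padic_cauchy_convergent[OF p c(2)] by (metis convergent_LIMSEQ_iff limI)
  have "padic_rel CARD('a) (\<lambda>n. inverse (X n)) (\<lambda>n. inverse (Y n))"
    if n: "\<not> (\<lambda>n. ?v (X n)) \<longlonglongrightarrow> 0" "\<not> (\<lambda>n. ?v (Y n)) \<longlonglongrightarrow> 0"
  proof -
    obtain a M where a: "a > 0" "\<And>n. n \<ge> M \<Longrightarrow> ?v (X n) > a"
      using padic_cauchy_not_null[OF p c(1) n(1)] by blast
    obtain b N where b: "b > 0" "\<And>n. n \<ge> N \<Longrightarrow> ?v (Y n) > b"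
      using padic_cauchy_not_null[OF p c(2) n(2)] by blast
    have lim: "(\<lambda>n. ?v (X n - Y n) / (a * b)) \<longlonglongrightarrow> 0 / (a * b)"
      using R a b by (intro tendsto_intros) (auto simp: padic_rel_def)
    have le: "?v (inverse (X n) - inverse (Y n)) \<le> ?v (X n - Y n) / (a * b)"
      if mn: "n \<ge> max M N" for n
    proof -
      have cm: "?v (X n) > a" "?v (Y n) > b" using a b mn by auto
      hence nz: "X n \<noteq> 0" "Y n \<noteq> 0" using a b by auto
      hence "?v (inverse (X n) - inverse (Y n)) = ?v (X n - Y n) / (?v (X n) * ?v (Y n))"
        by (rule padic_abs_rat_inverse_diff[OF p])
      also have "\<dots> \<le> ?v (X n - Y n) / (a * b)"
        using cm a b by (intro divide_left_mono mult_mono mult_pos_pos padic_abs_rat_nonneg) auto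
      finally show ?thesis .
    qed
    have lim0: "(\<lambda>n. ?v (inverse (X n) - inverse (Y n))) \<longlonglongrightarrow> 0"
    proof (rule tendsto_sandwich[OF _ _ tendsto_const])
      show "(\<lambda>n. ?v (X n - Y n) / (a * b)) \<longlonglongrightarrow> 0" using lim by simp
      show "\<forall>\<^sub>F n in sequentially. 0 \<le> ?v (inverse (X n) - inverse (Y n))"
        by (simp add: padic_abs_rat_nonneg)
      show "\<forall>\<^sub>F n in sequentially. ?v (inverse (X n) - inverse (Y n)) \<le> ?v (X n - Y n) / (a * b)"
        by (rule eventually_sequentiallyI[of "max M N"]) (rule le)
    qed
    show ?thesis unfolding padic_rel_def
      by (intro conjI padic_cauchy_inverse p c n lim0)
  qed
  thus "padic_rel CARD('a) (if (\<lambda>n. ?v (X n)) \<longlonglongrightarrow> 0 then \<lambda>n. 0 else (\<lambda>n. inverse (X n)))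
      (if (\<lambda>n. ?v (Y n)) \<longlonglongrightarrow> 0 then \<lambda>n. 0 else (\<lambda>n. inverse (Y n)))"
    using null by (auto simp: padic_rel_refl)
qed

definition minus_padic :: "'a padic \<Rightarrow> 'a padic \<Rightarrow> 'a padic" where
  "minus_padic x y = x + - y"

definition divide_padic :: "'a padic \<Rightarrow> 'a padic \<Rightarrow> 'a padic" where
  "divide_padic x y = x * inverse y"

instance
proof
  fix a b c :: "'a padic"
  note p = prime_card[where 'a='a]
  show "a + b + c = a + (b + c)"
    by transfer (rule padic_rel_eqI, intro padic_cauchy_add padic_cauchy_mult padic_cauchy_minus p; simp add: padic_rel_refl add.assoc)
  show "a + b = b + a"
    by transfer (rule padic_rel_eqI, intro padic_cauchy_add padic_cauchy_mult padic_cauchy_minus p; simp add: padic_rel_refl add.commute)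
  show "0 + a = a"
    by transfer (rule padic_rel_eqI, intro padic_cauchy_add padic_cauchy_mult padic_cauchy_minus p; simp add: padic_rel_refl )
  show "- a + a = 0"
    by transfer (rule padic_rel_eqI, intro padic_cauchy_add padic_cauchy_mult padic_cauchy_minus p; simp add: padic_rel_refl )
  show "a - b = a + - b" by (simp add: minus_padic_def)
  show "a * b * c = a * (b * c)"
    by transfer (rule padic_rel_eqI, intro padic_cauchy_add padic_cauchy_mult padic_cauchy_minus p; simp add: padic_rel_refl mult.assoc)
  show "a * b = b * a"
    by transfer (rule padic_rel_eqI, intro padic_cauchy_add padic_cauchy_mult padic_cauchy_minus p; simp add: padic_rel_refl mult.commute)
  show "1 * a = a"
    by transfer (rule padic_rel_eqI, intro padic_cauchy_add padic_cauchy_mult padic_cauchy_minus p; simp add: padic_rel_refl )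
  show "(a + b) * c = a * c + b * c"
    by transfer (rule padic_rel_eqI, intro padic_cauchy_add padic_cauchy_mult padic_cauchy_minus p; simp add: padic_rel_refl distrib_right)
  show "(0 :: 'a padic) \<noteq> 1"
    by transfer (simp add: padic_rel_def padic_abs_rat_minus[OF p] padic_abs_rat_1[OF p] LIMSEQ_const_iff)
  show "inverse (0 :: 'a padic) = 0"
    by transfer (simp add: padic_rel_refl)
  show "a div b = a * inverse b" by (simp add: divide_padic_def)
  show "a \<noteq> 0 \<Longrightarrow> inverse a * a = 1"
  proof transfer
    fix X assume X: "padic_rel CARD('a) X X" and nz: "\<not> padic_rel CARD('a) X (\<lambda>n. 0)"
    have c: "padic_cauchy CARD('a) X" using X by (simp add: padic_rel_refl)
    have n: "\<not> (\<lambda>n. padic_abs_rat CARD('a) (X n)) \<longlonglongrightarrow> 0"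
      using nz c by (simp add: padic_rel_def)
    obtain d M where d: "d > 0" "\<And>n. n \<ge> M \<Longrightarrow> padic_abs_rat CARD('a) (X n) > d"
      using padic_cauchy_not_null[OF p c n] by blast
    have "inverse (X n) * X n - 1 = 0" if "n \<ge> M" for n
    proof -
      have "X n \<noteq> 0" using d(1) d(2)[OF that] by auto
      thus ?thesis by simp
    qed
    hence "eventually (\<lambda>n. padic_abs_rat CARD('a) (inverse (X n) * X n - 1) = 0) sequentially"
      by (auto simp: eventually_sequentially intro!: exI[of _ M])
    hence "(\<lambda>n. padic_abs_rat CARD('a) (inverse (X n) * X n - 1)) \<longlonglongrightarrow> 0"
      by (rule tendsto_eventually)
    thus "padic_rel CARD('a) (\<lambda>n. (if (\<lambda>n. padic_abs_rat CARD('a) (X n)) \<longlonglongrightarrow> 0 then \<lambda>n. 0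
        else (\<lambda>n. inverse (X n))) n * X n) (\<lambda>n. 1)"
      using n c by (auto simp: padic_rel_def intro!: padic_cauchy_mult padic_cauchy_inverse p)
  qed
qed

end


section \<open>The absolute value and the metric\<close>

lift_definition padic_abs :: "'p::prime_card padic \<Rightarrow> real" is
  "\<lambda>X. lim (\<lambda>n. padic_abs_rat CARD('p) (X n))"
  by (rule padic_rel_limit[OF prime_card])

lemma padic_rel_tendsto_abs:
  assumes "padic_rel CARD('p::prime_card) X X"
  shows "(\<lambda>n. padic_abs_rat CARD('p) (X n)) \<longlonglongrightarrow> lim (\<lambda>n. padic_abs_rat CARD('p) (X n))"
  using padic_cauchy_convergent[OF prime_card] assms
  by (simp add: padic_rel_refl convergent_LIMSEQ_iff)

lemma padic_abs_nonneg: "padic_abs (x :: 'p::prime_card padic) \<ge> 0"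
  by transfer (rule LIMSEQ_le_const[OF padic_rel_tendsto_abs], auto simp: padic_abs_rat_nonneg)

lemma padic_abs_eq_0_iff: "padic_abs (x :: 'p::prime_card padic) = 0 \<longleftrightarrow> x = 0"
proof transfer
  fix X assume X: "padic_rel CARD('p) X X"
  have "padic_rel CARD('p) X (\<lambda>n. 0) \<longleftrightarrow> (\<lambda>n. padic_abs_rat CARD('p) (X n)) \<longlonglongrightarrow> 0"
    using X by (simp add: padic_rel_def)
  also have "\<dots> \<longleftrightarrow> lim (\<lambda>n. padic_abs_rat CARD('p) (X n)) = 0"
    using padic_rel_tendsto_abs[OF X] by (metis limI)
  finally show "(lim (\<lambda>n. padic_abs_rat CARD('p) (X n)) = 0) = padic_rel CARD('p) X (\<lambda>n. 0)" by simp
qed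

lemma padic_abs_minus: "padic_abs (- x) = padic_abs (x :: 'p::prime_card padic)"
  by transfer (simp add: padic_abs_rat_minus[OF prime_card])

lemma padic_abs_mult: "padic_abs (x * y) = padic_abs x * padic_abs (y :: 'p::prime_card padic)"
  by transfer (intro limI, simp add: padic_abs_rat_mult[OF prime_card] padic_rel_tendsto_abs tendsto_mult)

lemma padic_abs_ultrametric:
  "padic_abs (x + y) \<le> max (padic_abs x) (padic_abs (y :: 'p::prime_card padic))"
proof transfer
  fix X Y assume X: "padic_rel CARD('p) X X" and Y: "padic_rel CARD('p) Y Y"
  have XY: "padic_rel CARD('p) (\<lambda>n. X n + Y n) (\<lambda>n. X n + Y n)"
    using X Y by (auto simp: padic_rel_refl intro: padic_cauchy_add[OF prime_card])
  show "lim (\<lambda>n. padic_abs_rat CARD('p) (X n + Y n)) \<le>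
    max (lim (\<lambda>n. padic_abs_rat CARD('p) (X n))) (lim (\<lambda>n. padic_abs_rat CARD('p) (Y n)))"
    by (rule LIMSEQ_le[OF padic_rel_tendsto_abs[OF XY]
          tendsto_max[OF padic_rel_tendsto_abs[OF X] padic_rel_tendsto_abs[OF Y]]])
       (use padic_abs_rat_ultrametric[OF prime_card] in blast)
qed

lemma padic_abs_triangle: "padic_abs (x + y) \<le> padic_abs x + padic_abs (y :: 'p::prime_card padic)"
  using padic_abs_ultrametric[of x y] padic_abs_nonneg[of x] padic_abs_nonneg[of y] by linarith

lemma padic_abs_diff_commute: "padic_abs (x - y) = padic_abs (y - x :: 'p::prime_card padic)"
  using padic_abs_minus[of "x - y"] by simp

instantiation padic :: (prime_card) metric_space
begin

definition dist_padic :: "'a padic \<Rightarrow> 'a padic \<Rightarrow> real" where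
  "dist_padic x y = padic_abs (x - y)"

definition uniformity_padic :: "('a padic \<times> 'a padic) filter" where
  "uniformity_padic = (INF e\<in>{0<..}. principal {(x, y). dist x y < e})"

definition open_padic :: "'a padic set \<Rightarrow> bool" where
  "open_padic U \<longleftrightarrow> (\<forall>x\<in>U. eventually (\<lambda>(x', y). x' = x \<longrightarrow> y \<in> U) uniformity)"

instance
proof
  show "uniformity = (INF e\<in>{0<..}. principal {(x, y :: 'a padic). dist x y < e})"
    by (rule uniformity_padic_def)
  show "open U \<longleftrightarrow> (\<forall>x\<in>U. eventually (\<lambda>(x', y). x' = x \<longrightarrow> y \<in> U) uniformity)"
    for U :: "'a padic set" by (rule open_padic_def)
  show "dist x y = 0 \<longleftrightarrow> x = y" for x y :: "'a padic"
    by (simp add: dist_padic_def padic_abs_eq_0_iff)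
  show "dist x y \<le> dist x z + dist y z" for x y z :: "'a padic"
    using padic_abs_triangle[of "x - z" "z - y"] padic_abs_diff_commute[of y z]
    by (simp add: dist_padic_def)
qed

end

text \<open>The rationals are embedded with their \<open>p\<close>-adic absolute value, are dense, and
  \<open>'p padic\<close> is complete.\<close>

lift_definition padic_const :: "rat \<Rightarrow> 'p::prime_card padic" is "\<lambda>q n. q"
  by (simp add: padic_rel_refl)

lemma padic_const_simps:
  "padic_const 0 = 0" "padic_const 1 = 1"
  "padic_const (x + y) = padic_const x + padic_const y"
  "padic_const (- x) = - padic_const x"
  "padic_const (x * y) = padic_const x * padic_const y"
  by (transfer; simp add: padic_rel_refl)+

lemma padic_abs_const: "padic_abs (padic_const x :: 'p::prime_card padic) = padic_abs_rat CARD('p) x"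
  by transfer (simp add: limI)

lemma padic_const_of_nat: "padic_const (of_nat n) = of_nat n"
  by (induction n) (simp_all add: padic_const_simps)

lemma padic_const_of_int: "padic_const (of_int n) = of_int n"
  by (cases n rule: int_diff_cases)
     (simp add: padic_const_simps padic_const_of_nat diff_conv_add_uminus del: add_uminus_conv_diff)

instance padic :: (prime_card) field_char_0
proof
  show "inj (of_nat :: nat \<Rightarrow> 'a padic)"
  proof (rule injI)
    fix m n assume eq: "(of_nat m :: 'a padic) = of_nat n"
    have "padic_const (of_nat m + - of_nat n) = (0 :: 'a padic)"
      by (simp only: padic_const_simps padic_const_of_nat eq) simp
    hence "padic_abs_rat CARD('a) (of_nat m + - of_nat n) = 0"
      by (metis padic_abs_const padic_abs_eq_0_iff)
    thus "m = n" by (simp add: padic_abs_rat_eq_0_iff[OF prime_card])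
  qed
qed

lemma padic_const_eq_of_rat: "padic_const x = of_rat x"
proof -
  obtain a b where q: "quotient_of x = (a, b)" by fastforce
  have b: "b > 0" using quotient_of_denom_pos[OF q] .
  have x: "x = of_int a / of_int b" using quotient_of_div[OF q] .
  have "x * of_int b = of_int a" using b x by simp
  hence "padic_const x * of_int b = (of_int a :: 'a padic)"
    by (metis padic_const_simps(5) padic_const_of_int)
  hence "padic_const x = of_int a / (of_int b :: 'a padic)" using b by (simp add: field_simps)
  thus ?thesis by (simp add: x of_rat_divide)
qed

lemma padic_abs_of_rat: "padic_abs (of_rat x :: 'p::prime_card padic) = padic_abs_rat CARD('p) x"
  by (metis padic_abs_const padic_const_eq_of_rat)

lemma abs_padic_tendsto:
  assumes X: "padic_cauchy CARD('p::prime_card) X"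
  shows "(\<lambda>n. of_rat (X n)) \<longlonglongrightarrow> (abs_padic X :: 'p padic)"
proof (rule metric_LIMSEQ_I)
  fix e :: real assume e: "e > 0"
  then obtain N where N: "\<forall>m\<ge>N. \<forall>n\<ge>N. padic_abs_rat CARD('p) (X m - X n) < e / 2"
    using padic_cauchyD[OF X, of "e / 2"] by auto
  have "dist (of_rat (X m)) (abs_padic X :: 'p padic) < e" if m: "m \<ge> N" for m
  proof -
    have c: "padic_cauchy CARD('p) (\<lambda>n. X m + - X n)"
      using X by (intro padic_cauchy_add padic_cauchy_minus prime_card padic_cauchy_const)
    have "(of_rat (X m) - abs_padic X :: 'p padic) = padic_const (X m) + - abs_padic X"
      by (simp add: padic_const_eq_of_rat)
    also have "- abs_padic X = (abs_padic (\<lambda>n. - X n) :: 'p padic)"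
      using X by (intro uminus_padic.abs_eq) (simp add: padic_rel_refl)
    also have "padic_const (X m) = (abs_padic (\<lambda>n. X m) :: 'p padic)"
      by (rule padic_const.abs_eq)
    also have "abs_padic (\<lambda>n. X m) + abs_padic (\<lambda>n. - X n) = (abs_padic (\<lambda>n. X m + - X n) :: 'p padic)"
      using X by (intro plus_padic.abs_eq) (simp_all add: padic_rel_refl padic_cauchy_minus prime_card)
    finally have eq: "(of_rat (X m) - abs_padic X :: 'p padic) = abs_padic (\<lambda>n. X m + - X n)" .
    have n: "padic_abs (abs_padic (\<lambda>n. X m + - X n) :: 'p padic) =
        lim (\<lambda>n. padic_abs_rat CARD('p) (X m + - X n))"
      by (rule padic_abs.abs_eq) (simp only: padic_rel_refl c)
    have "lim (\<lambda>n. padic_abs_rat CARD('p) (X m + - X n)) \<le> e / 2"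
    proof (rule LIMSEQ_le_const2[OF padic_rel_tendsto_abs])
      show "padic_rel CARD('p) (\<lambda>n. X m + - X n) (\<lambda>n. X m + - X n)"
        by (simp only: padic_rel_refl c)
      show "\<exists>N. \<forall>n\<ge>N. padic_abs_rat CARD('p) (X m + - X n) \<le> e / 2"
        using N m by (intro exI[of _ N]) (simp add: less_imp_le)
    qed
    thus ?thesis using e n by (simp add: dist_padic_def eq)
  qed
  thus "\<exists>N. \<forall>m\<ge>N. dist (of_rat (X m)) (abs_padic X :: 'p padic) < e"
    by (intro exI[of _ N] allI impI)
qed

lemma padic_rat_dense:
  assumes "e > 0" shows "\<exists>q. dist (x :: 'p::prime_card padic) (of_rat q) < e"
proof -
  have "padic_rel CARD('p) (rep_padic x) (rep_padic x)" "abs_padic (rep_padic x) = x"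
    using Quotient_rep_reflp[OF Quotient_padic] Quotient_abs_rep[OF Quotient_padic] by blast+
  hence "(\<lambda>n. of_rat (rep_padic x n)) \<longlonglongrightarrow> x"
    using abs_padic_tendsto[of "rep_padic x", where 'p='p] by (simp add: padic_rel_refl)
  from metric_LIMSEQ_D[OF this assms] show ?thesis by (auto simp: dist_commute)
qed

instance padic :: (prime_card) complete_space
proof
  fix x :: "nat \<Rightarrow> 'a padic" assume x: "Cauchy x"
  have "\<forall>k. \<exists>q. dist (x k) (of_rat q) < inverse (real (Suc k))"
    by (intro allI padic_rat_dense) simp
  then obtain q where q: "\<And>k. dist (x k) (of_rat (q k)) < inverse (real (Suc k))" by metis
  have d: "(\<lambda>k. dist (x k) (of_rat (q k))) \<longlonglongrightarrow> 0"
  proof (rule tendsto_sandwich[OF _ _ tendsto_const LIMSEQ_inverse_real_of_nat])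
    show "\<forall>\<^sub>F k in sequentially. dist (x k) (of_rat (q k)) \<le> inverse (real (Suc k))"
      by (intro always_eventually allI less_imp_le q)
  qed simp
  have "padic_cauchy CARD('a) q"
    unfolding padic_cauchy_def
  proof (intro allI impI)
    fix e :: real assume e: "e > 0"
    have e3: "e / 3 > 0" using e by simp
    from metric_CauchyD[OF x e3]
    obtain M where M: "\<forall>m\<ge>M. \<forall>n\<ge>M. dist (x m) (x n) < e / 3" by (elim exE)
    from order_tendstoD(2)[OF d e3]
    obtain K where K: "\<forall>k\<ge>K. dist (x k) (of_rat (q k)) < e / 3"
      unfolding eventually_sequentially by (elim exE)
    have "padic_abs_rat CARD('a) (q m - q n) < e" if "m \<ge> max M K" "n \<ge> max M K" for m n
    proof -
      have "padic_abs_rat CARD('a) (q m - q n) = dist (of_rat (q m) :: 'a padic) (of_rat (q n))"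
        by (simp add: dist_padic_def padic_abs_of_rat flip: of_rat_diff)
      also have "\<dots> \<le> dist (x m) (of_rat (q m)) + dist (x m) (x n) + dist (x n) (of_rat (q n))"
        using dist_triangle[of "of_rat (q m)" "of_rat (q n)" "x m"]
          dist_triangle[of "x m" "of_rat (q n)" "x n"] by (simp add: dist_commute)
      also have "\<dots> < e" using M[rule_format, of m n] K[rule_format, of m] K[rule_format, of n] that
        by simp
      finally show ?thesis .
    qed
    thus "\<exists>N. \<forall>m\<ge>N. \<forall>n\<ge>N. padic_abs_rat CARD('a) (q m - q n) < e"
      by (intro exI[of _ "max M K"] allI impI)
  qed
  hence l: "(\<lambda>k. of_rat (q k)) \<longlonglongrightarrow> (abs_padic q :: 'a padic)" by (rule abs_padic_tendsto)
  have "x \<longlonglongrightarrow> abs_padic q"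
  proof (rule metric_LIMSEQ_I)
    fix e :: real assume e: "e > 0"
    hence e2: "e / 2 > 0" by simp
    from order_tendstoD(2)[OF d e2]
    obtain K where K: "\<forall>k\<ge>K. dist (x k) (of_rat (q k)) < e / 2"
      unfolding eventually_sequentially by (elim exE)
    from metric_LIMSEQ_D[OF l e2]
    obtain M where M: "\<forall>k\<ge>M. dist (of_rat (q k)) (abs_padic q :: 'a padic) < e / 2" by (elim exE)
    have "dist (x k) (abs_padic q) < e" if "k \<ge> max K M" for k
      using dist_triangle[of "x k" "abs_padic q" "of_rat (q k)"]
        K[rule_format, of k] M[rule_format, of k] that by simp
    thus "\<exists>N. \<forall>k\<ge>N. dist (x k) (abs_padic q) < e" by (intro exI[of _ "max K M"] allI impI)
  qed
  thus "convergent x" by (rule convergentI)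
qed


section \<open>Haar measure\<close>

definition padic_haar :: "'p::prime_card padic measure \<Rightarrow> bool" where
  "padic_haar \<mu> \<longleftrightarrow> sets \<mu> = sets borel \<and>
     (\<forall>a. \<forall>A\<in>sets borel. emeasure \<mu> ((\<lambda>x. a + x) ` A) = emeasure \<mu> A) \<and>
     emeasure \<mu> {x. padic_abs x \<le> 1} = 1"


section \<open>Cesaro spaces and the integral operator\<close>

text \<open>Only used for exponents \<open>a > 0\<close>, hence \<open>\<infinity>\<close> to the power \<open>a\<close> is \<open>\<infinity>\<close>.\<close>

definition ennreal_powr :: "ennreal \<Rightarrow> real \<Rightarrow> ennreal" where
  "ennreal_powr x a = (if x = \<infinity> then \<infinity> else ennreal (enn2real x powr a))"

text \<open>The measure \<open>M\<close> stands for \<open>dx\<close>.  At the null point \<open>x = 0\<close> the factor \<open>1 / padic_abs x\<close>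
  is \<open>0\<close> by convention.\<close>

definition ces_norm ::
  "'p::prime_card padic measure \<Rightarrow> real \<Rightarrow> ('p padic \<Rightarrow> complex) \<Rightarrow> ennreal" where
  "ces_norm M r f = ennreal_powr
     (\<integral>\<^sup>+x. ennreal_powr
        (ennreal (1 / padic_abs x) *
          (\<integral>\<^sup>+y\<in>{y. padic_abs y \<le> padic_abs x}. ennreal (norm (f y)) \<partial>M)) r \<partial>M) (1 / r)"

definition ces_space ::
  "'p::prime_card padic measure \<Rightarrow> real \<Rightarrow> ('p padic \<Rightarrow> complex) set" where
  "ces_space M r = {f \<in> borel_measurable M. ces_norm M r f < \<infinity>}"

definition kernel_integrand ::
  "(real \<Rightarrow> real \<Rightarrow> real) \<Rightarrow> ('p::prime_card padic \<Rightarrow> complex) \<Rightarrow> 'p padic \<Rightarrow> 'p padic \<Rightarrow> complex" where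
  "kernel_integrand K f x y = complex_of_real (K (padic_abs x) (padic_abs y)) * f y"

definition kernel_op ::
  "'p::prime_card padic measure \<Rightarrow> (real \<Rightarrow> real \<Rightarrow> real) \<Rightarrow> ('p padic \<Rightarrow> complex) \<Rightarrow> 'p padic \<Rightarrow> complex"
  where "kernel_op M K f x = (LINT y:- {0}|M. kernel_integrand K f x y)"

definition kernel_const :: "nat \<Rightarrow> (real \<Rightarrow> real \<Rightarrow> real) \<Rightarrow> real \<Rightarrow> ennreal" where
  "kernel_const p K r = ennreal (1 - 1 / real p) *
     (\<Sum>\<^sub>\<infinity>j\<in>(UNIV :: int set).
        ennreal (K 1 (real p powi j) * real p powr (real_of_int j * (1 - 1 / r))))"

end

theory Submission
  imports Defs
begin

text \<open>
  Write \<open>q = 1 - 1 / p\<close>.  Away from the null point \<open>0\<close>, the field is the disjoint union of the spheres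
  of radius \<open>p powi k\<close>, whose measure is \<open>q * p powi k\<close>.  Kernel and averages depend only on absolute
  values, so the problem becomes one about sequences indexed by \<open>\<int>\<close>.  Let
  \<open>J k\<close> be the integral of the absolute value of \<open>f\<close> over the ball of radius \<open>p powi k\<close>, and let
  \<open>h k = p powr (- k * (1 - 1 / r)) * J k\<close>.  Then the Cesaro norm of \<open>f\<close> is
  the \<open>\<ell>\<^sup>r\<close>-norm of \<open>h\<close> times the \<open>r\<close>-th root of \<open>q\<close> (\<open>ces_norm_eq_ces_seq\<close>).

  Let \<open>T\<close> be the operator with kernel \<open>K\<close>, applied to the absolute value of \<open>f\<close>; the result
  dominates the operator of the theorem pointwise.  By homogeneity the value of \<open>T f\<close> on the
  \<open>i\<close>-th sphere is \<open>p powi (- i)\<close> times the sum over \<open>m\<close> of \<open>K 1 (p powi m)\<close> times the integral of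
  the absolute value of \<open>f\<close> over the sphere \<open>i + m\<close>.  When this is integrated over a ball, the factor
  \<open>p powi (- i)\<close> cancels the measure of the sphere up to \<open>q\<close>, and \<open>T\<close> acts on \<open>J\<close>, hence on \<open>h\<close>, as
  a convolution: the sequence of \<open>T f\<close> at \<open>k\<close> is the sum over \<open>m\<close> of \<open>c m * h (k + m)\<close>, where
  \<open>c m = q * K 1 (p powi m) * p powr (m * (1 - 1 / r))\<close> (\<open>ces_seq_nn_kernel_op\<close>).  The numbers
  \<open>c m\<close> sum to the constant of the theorem, and Young's inequality on \<open>\<int>\<close>
  (\<open>Young_convolution_int\<close>) gives the norm bound.

  Convergence comes out of the same estimate.  All of it is carried out in \<open>[0, \<infinity>]\<close>; a
  finite Cesaro norm forces a radial function to be finite on every sphere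
  (\<open>radial_finite_if_ces_seq_finite\<close>), and this is the absolute convergence of the integral defining the
  operator.
\<close>

section \<open>Powers and sums of extended nonnegative reals\<close>

lemma ennreal_powr_ennreal: "0 \<le> x \<Longrightarrow> ennreal_powr (ennreal x) a = ennreal (x powr a)"
  by (simp add: ennreal_powr_def)

lemma ennreal_powr_top [simplified, simp]: "ennreal_powr \<infinity> a = \<infinity>"
  by (simp add: ennreal_powr_def)

lemma ennreal_powr_0 [simp]: "ennreal_powr 0 a = 0"
  by (simp add: ennreal_powr_def)

lemma ennreal_powr_less_top_iff [simp]: "ennreal_powr x a < \<infinity> \<longleftrightarrow> x < \<infinity>"
  by (auto simp: ennreal_powr_def less_top)

lemma ennreal_powr_eq_0_iff [simp]: "ennreal_powr x a = 0 \<longleftrightarrow> x = 0"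
  by (cases x) (auto simp: ennreal_powr_def)

lemma ennreal_powr_mono:
  assumes "0 \<le> a" "x \<le> y"
  shows "ennreal_powr x a \<le> ennreal_powr y a"
proof (cases "y = \<infinity>")
  case False
  with assms(2) have "x \<noteq> \<infinity>" using top.extremum_unique by fastforce
  thus ?thesis using False assms
    by (auto simp: ennreal_powr_def less_top intro!: ennreal_leI powr_mono2 enn2real_mono)
qed simp

text \<open>Since \<open>\<infinity>\<close> to any power is \<open>\<infinity>\<close>, the two sides agree also when one factor is \<open>0\<close>
  and the other is infinite.\<close>

lemma ennreal_powr_mult: "ennreal_powr (x * y) a = ennreal_powr x a * ennreal_powr y a"
proof (cases "x = 0 \<or> y = 0")
  case False
  show ?thesis
  proof (cases "x = \<infinity> \<or> y = \<infinity>")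
    case True
    with False show ?thesis
      by (elim disjE) (simp_all add: ennreal_top_mult ennreal_mult_top)
  next
    case False
    obtain u where "x = ennreal u" "0 \<le> u" using False by (cases x) auto
    moreover obtain v where "y = ennreal v" "0 \<le> v" using False by (cases y) auto
    ultimately show ?thesis
      by (simp add: ennreal_powr_ennreal powr_mult flip: ennreal_mult)
  qed
qed auto

lemma ennreal_powr_powr: "ennreal_powr (ennreal_powr x a) b = ennreal_powr x (a * b)"
  by (auto simp: ennreal_powr_def powr_powr)

lemma ennreal_powr_1 [simp]: "ennreal_powr x 1 = x"
  by (cases x) (auto simp: ennreal_powr_def)

lemma measurable_ennreal_powr [measurable]:
  "(\<lambda>x. ennreal_powr x a) \<in> borel_measurable borel"
  unfolding ennreal_powr_def by measurable

lemma nn_integral_count_space_eq_infsum: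
  fixes f :: "'a \<Rightarrow> ennreal"
  assumes "countable A"
  shows "(\<integral>\<^sup>+x. f x \<partial>count_space A) = infsum f A"
proof (rule antisym)
  show "(\<integral>\<^sup>+x. f x \<partial>count_space A) \<le> infsum f A"
  proof (cases "finite A")
    case True
    thus ?thesis by (simp add: nn_integral_count_space_finite)
  next
    case False
    hence bij: "bij_betw (from_nat_into A) UNIV A"
      by (intro bij_betw_from_nat_into assms)
    have "(\<integral>\<^sup>+x. f x \<partial>count_space A) = (\<Sum>n. f (from_nat_into A n))"
      by (simp add: nn_integral_bij_count_space[OF bij, symmetric] nn_integral_count_space_nat)
    also have "\<dots> = (SUP n. sum f (from_nat_into A ` {..<n}))"
    proof -
      have "(\<Sum>i<n. f (from_nat_into A i)) = sum f (from_nat_into A ` {..<n})" for n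
        using bij by (subst sum.reindex) (auto simp: bij_betw_def intro: inj_on_subset)
      thus ?thesis by (simp only: suminf_eq_SUP)
    qed
    also have "\<dots> \<le> infsum f A"
    proof (subst nonneg_infsum_complete, simp, rule SUP_least)
      fix n :: nat
      have "from_nat_into A ` {..<n} \<subseteq> A" using bij by (auto simp: bij_betw_def)
      thus "sum f (from_nat_into A ` {..<n}) \<le> (SUP F\<in>{F. finite F \<and> F \<subseteq> A}. sum f F)"
        by (intro SUP_upper) auto
    qed
    finally show ?thesis .
  qed
  have "sum f F \<le> (\<integral>\<^sup>+x. f x \<partial>count_space A)" if "finite F" "F \<subseteq> A" for F
  proof -
    have "sum f F = (\<integral>\<^sup>+x. f x * indicator F x \<partial>count_space A)"
      using that by (subst nn_integral_count_space'[where A = F]) auto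
    also have "\<dots> \<le> (\<integral>\<^sup>+x. f x \<partial>count_space A)"
      by (intro nn_integral_mono) (simp split: split_indicator)
    finally show ?thesis .
  qed
  thus "infsum f A \<le> (\<integral>\<^sup>+x. f x \<partial>count_space A)"
    by (subst nonneg_infsum_complete, simp, intro SUP_least) simp
qed

text \<open>A convex function lies above its tangents.  Here the function is the \<open>r\<close>-th power, the
  tangent touches at \<open>s\<close>, and the inequality is Young's inequality for the product of
  \<open>x\<close> and \<open>s powr (r - 1)\<close>.\<close>

lemma ennreal_powr_tangent:
  assumes r: "1 < r" and s: "0 < s"
  shows "ennreal (r * s powr (r - 1)) * x \<le> ennreal_powr x r + ennreal ((r - 1) * s powr r)"
proof (cases x)
  case (real t)
  define q where "q = r / (r - 1)"
  have q: "1 < q" "1 / r + 1 / q = 1" "(r - 1) * q = r" "r / q = r - 1"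
    using r by (simp_all add: q_def field_simps)
  have "t * s powr (r - 1) \<le> t powr r / r + (s powr (r - 1)) powr q / q"
    using r q real by (intro Youngs_inequality) auto
  also have "(s powr (r - 1)) powr q = s powr r" by (simp add: powr_powr q)
  finally have "r * (t * s powr (r - 1)) \<le> r * (t powr r / r + s powr r / q)"
    using r by (intro mult_left_mono) auto
  also have "\<dots> = t powr r + r / q * s powr r" using r by (simp add: field_simps)
  finally have "r * s powr (r - 1) * t \<le> t powr r + (r - 1) * s powr r"
    by (simp add: q mult_ac)
  thus ?thesis using real r
    by (simp add: ennreal_powr_ennreal flip: ennreal_mult ennreal_plus)
qed simp

text \<open>This is Jensen's inequality for the measure with density \<open>c\<close>; the factor
  \<open>(\<integral>c) powr (r - 1)\<close> appears because \<open>c\<close> is not normalised to total mass one.  Integrating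
  the tangent inequality gives a bound for each point of tangency, and the mean value of
  \<open>g\<close> is the best one.\<close>

lemma ennreal_powr_nn_integral_le:
  assumes [measurable]: "c \<in> borel_measurable M" "g \<in> borel_measurable M"
    and r: "1 < r" and fin: "(\<integral>\<^sup>+x. c x \<partial>M) < \<infinity>"
  shows "ennreal_powr (\<integral>\<^sup>+x. c x * g x \<partial>M) r \<le>
    ennreal_powr (\<integral>\<^sup>+x. c x \<partial>M) (r - 1) * (\<integral>\<^sup>+x. c x * ennreal_powr (g x) r \<partial>M)"
    (is "ennreal_powr ?X r \<le> ennreal_powr ?D (r - 1) * ?S")
proof -
  have tangent: "ennreal (r * s powr (r - 1)) * ?X \<le> ?S + ennreal ((r - 1) * s powr r) * ?D"
    if "0 < s" for s
  proof -
    have "ennreal (r * s powr (r - 1)) * ?X = (\<integral>\<^sup>+x. c x * (ennreal (r * s powr (r - 1)) * g x) \<partial>M)"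
      by (subst nn_integral_cmult[symmetric]) (auto simp: mult_ac intro!: nn_integral_cong)
    also have "\<dots> \<le> (\<integral>\<^sup>+x. c x * (ennreal_powr (g x) r + ennreal ((r - 1) * s powr r)) \<partial>M)"
      using r that by (intro nn_integral_mono mult_left_mono ennreal_powr_tangent) auto
    also have "\<dots> = ?S + ennreal ((r - 1) * s powr r) * ?D"
      by (simp add: distrib_left nn_integral_add nn_integral_multc mult.commute)
    finally show ?thesis .
  qed
  show ?thesis
  proof (cases "?D = 0 \<or> ?X = 0")
    case True
    have "?X = 0"
    proof (cases "?D = 0")
      case True
      hence "AE x in M. c x = 0" by (simp add: nn_integral_0_iff_AE)
      thus ?thesis by (subst nn_integral_0_iff_AE) (auto elim!: eventually_mono)
    qed (use True in simp)
    thus ?thesis by simp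
  next
    case nz: False
    show ?thesis
    proof (cases "?S = \<infinity>")
      case True
      thus ?thesis using nz by (simp add: ennreal_mult_top)
    next
      case False
      \<comment> \<open>the tangent at \<open>s = 1\<close> shows that the left-hand side is finite\<close>
      have "ennreal r * ?X \<le> ?S + ennreal (r - 1) * ?D" using tangent[of 1] by simp
      also have "\<dots> < \<infinity>" using False fin by (simp add: ennreal_mult_less_top less_top)
      finally have "?X < \<infinity>" using r by (auto simp: ennreal_mult_less_top)
      then obtain x where x: "?X = ennreal x" "0 \<le> x" by (cases ?X) auto
      obtain d where d: "?D = ennreal d" "0 \<le> d" using fin by (cases ?D) auto
      obtain b where b: "?S = ennreal b" "0 \<le> b" using False by (cases ?S) auto
      have pos: "0 < x" "0 < d" using nz x d by auto
      \<comment> \<open>the best tangent touches at the mean value \<open>x / d\<close>\<close>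
      have "ennreal (r * (x / d) powr (r - 1) * x) \<le> ennreal (b + (r - 1) * (x / d) powr r * d)"
        using tangent[of "x / d"] pos r x d b by (simp flip: ennreal_mult ennreal_plus)
      hence "r * (x / d) powr (r - 1) * x \<le> b + (r - 1) * (x / d) powr r * d"
        using pos r b by (subst (asm) ennreal_le_iff) auto
      hence "r * (x powr r / d powr (r - 1)) \<le> b + (r - 1) * (x powr r / d powr (r - 1))"
        using pos by (simp add: powr_divide powr_diff)
      hence "x powr r / d powr (r - 1) \<le> b" by (simp only: left_diff_distrib mult_1)
      hence "x powr r \<le> d powr (r - 1) * b" using pos by (simp add: field_simps)
      thus ?thesis using x d b pos
        by (simp add: ennreal_powr_ennreal ennreal_leI flip: ennreal_mult)
    qed
  qed
qed

lemma nn_integral_count_space_shift: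
  fixes f :: "int \<Rightarrow> ennreal"
  shows "(\<integral>\<^sup>+k. f (k + m) \<partial>count_space UNIV) = (\<integral>\<^sup>+k. f k \<partial>count_space UNIV)"
  by (rule nn_integral_bij_count_space)
    (rule bij_betwI[where g = "\<lambda>k. k - m"], auto)

text \<open>Young's convolution inequality \<open>\<ell>\<^sup>1 * \<ell>\<^sup>r \<subseteq> \<ell>\<^sup>r\<close> on the integers.  Jensen's inequality moves
  the \<open>r\<close>-th power inside the sum over \<open>m\<close>; after exchanging the sums, translation invariance
  removes the shift by \<open>m\<close>.\<close>

lemma Young_convolution_int:
  fixes c h :: "int \<Rightarrow> ennreal"
  assumes r: "1 < r" and fin: "(\<integral>\<^sup>+m. c m \<partial>count_space UNIV) < \<infinity>"
  shows "(\<integral>\<^sup>+k. ennreal_powr (\<integral>\<^sup>+m. c m * h (k + m) \<partial>count_space UNIV) r \<partial>count_space UNIV) \<le>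
    ennreal_powr (\<integral>\<^sup>+m. c m \<partial>count_space UNIV) r *
      (\<integral>\<^sup>+k. ennreal_powr (h k) r \<partial>count_space UNIV)" (is "?L \<le> ennreal_powr ?D r * ?H")
proof -
  have "?L \<le> (\<integral>\<^sup>+k. ennreal_powr ?D (r - 1) *
      (\<integral>\<^sup>+m. c m * ennreal_powr (h (k + m)) r \<partial>count_space UNIV) \<partial>count_space UNIV)"
    by (intro nn_integral_mono ennreal_powr_nn_integral_le r fin) auto
  also have "\<dots> = ennreal_powr ?D (r - 1) *
      (\<integral>\<^sup>+m. \<integral>\<^sup>+k. c m * ennreal_powr (h (k + m)) r \<partial>count_space UNIV \<partial>count_space UNIV)"
    by (simp add: nn_integral_cmult nn_integral_count_space_nn_integral)
  also have "\<dots> = ennreal_powr ?D (r - 1) * (?D * ?H)"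
    by (simp add: nn_integral_cmult nn_integral_multc
        nn_integral_count_space_shift[of "\<lambda>k. ennreal_powr (h k) r"])
  also have "\<dots> = ennreal_powr ?D r * ?H"
  proof -
    obtain d where d: "?D = ennreal d" "0 \<le> d" using fin by (cases ?D) auto
    have "d powr (r - 1) * d = d powr r" using d(2) by (cases "d = 0") (simp_all add: powr_diff)
    thus ?thesis using d
      by (simp only: mult.assoc[symmetric] ennreal_powr_ennreal powr_ge_zero flip: ennreal_mult)
  qed
  finally show ?thesis .
qed

section \<open>Balls and spheres in the \<open>p\<close>-adic numbers\<close>

definition padic_ball :: "int \<Rightarrow> 'p::prime_card padic set" where
  "padic_ball k = {x. padic_abs x \<le> real CARD('p) powi k}"

definition padic_sphere :: "int \<Rightarrow> 'p::prime_card padic set" where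
  "padic_sphere k = {x. padic_abs x = real CARD('p) powi k}"

lemma CARD_gt_1: "real CARD('p::prime_card) > 1"
  using prime_gt_1_nat[OF prime_card, where 'a1='p] by simp

lemma CARD_powi_le_iff:
  "real CARD('p::prime_card) powi i \<le> real CARD('p) powi j \<longleftrightarrow> i \<le> j"
  using power_int_increasing[of i j "real CARD('p)"]
    power_int_strict_increasing[of j i "real CARD('p)"] CARD_gt_1[where 'p='p]
  by (meson leD le_less_linear less_imp_le)

lemma CARD_powi_eq_iff:
  "real CARD('p::prime_card) powi i = real CARD('p) powi j \<longleftrightarrow> i = j"
  by (metis CARD_powi_le_iff order.antisym order.refl)

lemma CARD_powi_pos [simp]: "0 < real CARD('p::prime_card) powi i"
  using CARD_gt_1[where 'p='p] by (intro zero_less_power_int) simp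

text \<open>In an ultrametric triangle the two longest sides are equal.\<close>

lemma padic_abs_eq_if_close:
  fixes x y :: "'p::prime_card padic"
  assumes "padic_abs (x - y) < padic_abs x"
  shows "padic_abs y = padic_abs x"
  using padic_abs_ultrametric[of "x - y" y] padic_abs_ultrametric[of "y - x" x] assms
  by (auto simp: padic_abs_diff_commute[of y x] max_def split: if_splits)

text \<open>By density of the rationals and the previous lemma, the completion has no new absolute
  values.\<close>

lemma padic_abs_value_group:
  fixes x :: "'p::prime_card padic"
  assumes "x \<noteq> 0"
  obtains k where "x \<in> padic_sphere k"
proof -
  have "padic_abs x > 0"
    using assms padic_abs_nonneg[of x] padic_abs_eq_0_iff[of x] by linarith
  then obtain q where "dist x (of_rat q) < padic_abs x"
    using padic_rat_dense by blast
  hence q: "padic_abs (of_rat q :: 'p padic) = padic_abs x"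
    by (intro padic_abs_eq_if_close) (simp add: dist_padic_def)
  hence "q \<noteq> 0" using \<open>padic_abs x > 0\<close> by (auto simp: padic_abs_of_rat)
  hence "\<exists>k. padic_abs_rat CARD('p) q = real CARD('p) powi k"
    unfolding padic_abs_rat_def by (auto split: prod.splits)
  thus ?thesis using q that by (auto simp: padic_abs_of_rat padic_sphere_def)
qed

lemma padic_ball_diff_iff:
  fixes x y :: "'p::prime_card padic"
  assumes "y \<in> padic_ball k"
  shows "x - y \<in> padic_ball k \<longleftrightarrow> x \<in> padic_ball k"
  using padic_abs_ultrametric[of "x - y" y] padic_abs_ultrametric[of x "- y"] assms
  by (auto simp: padic_ball_def padic_abs_minus max_def split: if_splits)

lemma padic_sphere_eq_ball_diff:
  "padic_sphere k = (padic_ball k - padic_ball (k - 1) :: 'p::prime_card padic set)"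
proof (intro equalityI subsetI)
  fix x :: "'p padic" assume x: "x \<in> padic_ball k - padic_ball (k - 1)"
  hence "x \<noteq> 0"
    by (auto simp: padic_ball_def padic_abs_eq_0_iff[THEN iffD2] less_imp_le)
  then obtain l where l: "x \<in> padic_sphere l" by (rule padic_abs_value_group)
  with x have "l \<le> k" "\<not> l \<le> k - 1"
    by (auto simp: padic_ball_def padic_sphere_def CARD_powi_le_iff)
  hence "l = k" by simp
  with l show "x \<in> padic_sphere k" by simp
qed (auto simp: padic_ball_def padic_sphere_def CARD_powi_le_iff)

lemma padic_abs_power_int:
  "padic_abs (x powi k) = padic_abs (x :: 'p::prime_card padic) powi k"
proof -
  have 1: "padic_abs (1 :: 'p padic) = 1"
    using padic_abs_of_rat[of 1, where 'p='p] prime_card[where 'a='p] by simp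
  have pow: "padic_abs (y ^ n) = padic_abs y ^ n" for y :: "'p padic" and n
    by (induction n) (simp_all add: 1 padic_abs_mult)
  have inv: "padic_abs (inverse y) = inverse (padic_abs y)" for y :: "'p padic"
  proof (cases "y = 0")
    case False
    thus ?thesis
      using padic_abs_mult[of y "inverse y"] by (simp add: 1 inverse_unique)
  qed (simp add: padic_abs_eq_0_iff[THEN iffD2])
  show ?thesis by (simp add: power_int_def pow inv)
qed

lemma padic_abs_CARD: "padic_abs (of_nat CARD('p) :: 'p::prime_card padic) = inverse (real CARD('p))"
proof -
  have "multiplicity (int CARD('p)) (int CARD('p)) = 1"
    using prime_card[where 'a='p] prime_gt_1_nat[OF prime_card[where 'a='p]]
    by (intro multiplicity_self) auto
  thus ?thesis
    using padic_abs_of_rat[of "of_nat CARD('p)", where 'p='p]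
      padic_abs_rat_frac[OF prime_card[where 'a='p], of "int CARD('p)" 1]
    by (simp add: power_int_minus)
qed

lemma padic_abs_of_int_lt_1_iff:
  "padic_abs (of_int n :: 'p::prime_card padic) < 1 \<longleftrightarrow> int CARD('p) dvd n"
proof (cases "n = 0")
  case False
  have "real CARD('p) powi (- int (multiplicity (int CARD('p)) n)) < 1 \<longleftrightarrow>
      \<not> real CARD('p) powi 0 \<le> real CARD('p) powi (- int (multiplicity (int CARD('p)) n))"
    by auto
  also have "\<dots> \<longleftrightarrow> 0 < multiplicity (int CARD('p)) n"
    by (subst CARD_powi_le_iff) auto
  also have "\<dots> \<longleftrightarrow> int CARD('p) dvd n"
    using False prime_card[where 'a='p]
    by (subst prime_multiplicity_gt_zero_iff) auto
  finally show ?thesis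
    using False padic_abs_of_rat[of "of_int n", where 'p='p]
      padic_abs_rat_frac[OF prime_card[where 'a='p], of n 1]
    by simp
qed (simp add: padic_abs_eq_0_iff[THEN iffD2])

text \<open>The residue field has \<open>p\<close> elements.  Approximate \<open>x\<close> by a rational number \<open>c / d\<close> with
  \<open>d\<close> prime to \<open>p\<close>, and solve \<open>a d \<equiv> c\<close> modulo \<open>p\<close>.\<close>

lemma padic_residue:
  fixes x :: "'p::prime_card padic"
  assumes "padic_abs x \<le> 1"
  obtains a where "a < CARD('p)" "padic_abs (x - of_nat a) < 1"
proof -
  let ?p = "int CARD('p)"
  obtain q where q: "dist x (of_rat q) < 1"
    using padic_rat_dense zero_less_one by blast
  obtain c d where cd: "quotient_of q = (c, d)" by fastforce
  have d: "d > 0" "coprime c d"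
    using quotient_of_denom_pos[OF cd] quotient_of_coprime[OF cd] by auto
  have q_eq: "q = of_int c / of_int d" using quotient_of_div[OF cd] .
  have rat_eq: "(of_rat q :: 'p padic) * of_int d = of_int c"
    using d by (simp add: q_eq of_rat_divide)
  have "padic_abs (of_rat q :: 'p padic) \<le> 1"
    using padic_abs_ultrametric[of "of_rat q - x" x] q assms
    by (simp add: dist_padic_def padic_abs_diff_commute)
  hence cle: "padic_abs (of_int c :: 'p padic) \<le> padic_abs (of_int d :: 'p padic)"
    by (metis padic_abs_mult padic_abs_nonneg mult_left_le_one_le rat_eq)
  \<comment> \<open>a denominator divisible by \<open>p\<close> would force the same of the numerator\<close>
  have ndvd: "\<not> ?p dvd d"
  proof
    assume dvd: "?p dvd d"
    hence "?p dvd c" using cle by (simp flip: padic_abs_of_int_lt_1_iff)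
    with dvd d(2) have "?p dvd 1" using coprime_common_divisor by blast
    thus False using prime_gt_1_nat[OF prime_card[where 'a='p]] by auto
  qed
  have "prime ?p" using prime_card[where 'a='p] by simp
  hence "coprime d ?p" using prime_imp_coprime[OF _ ndvd] by (simp only: coprime_commute)
  then obtain e where e: "[d * e = 1] (mod ?p)" using cong_solve_coprime_int by blast
  define a where "a = (c * e) mod ?p"
  have "[a * d = c * (d * e)] (mod ?p)"
    by (simp add: a_def cong_def mod_simps mult_ac)
  also have "[c * (d * e) = c * 1] (mod ?p)" by (intro cong_mult cong_refl e)
  finally have "?p dvd c - a * d" by (simp add: cong_iff_dvd_diff dvd_diff_commute)
  hence num: "padic_abs (of_int (c - a * d) :: 'p padic) < 1"
    by (simp only: padic_abs_of_int_lt_1_iff)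
  have den: "padic_abs (of_int d :: 'p padic) \<ge> 1"
    using ndvd by (simp flip: padic_abs_of_int_lt_1_iff)
  have "(of_rat q - of_int a) * of_int d = (of_int (c - a * d) :: 'p padic)"
    by (simp add: left_diff_distrib rat_eq)
  hence "padic_abs (of_rat q - of_int a :: 'p padic) * padic_abs (of_int d :: 'p padic) < 1"
    by (metis num padic_abs_mult)
  hence "padic_abs (of_rat q - of_int a :: 'p padic) < 1"
    using den padic_abs_nonneg[of "of_rat q - of_int a :: 'p padic"]
    by (smt (verit) mult_left_mono mult_cancel_left1)
  hence "padic_abs (x - of_int a) < 1"
    using padic_abs_ultrametric[of "x - of_rat q" "of_rat q - of_int a"] q
    by (simp add: dist_padic_def)
  moreover have "a \<ge> 0" "a < ?p" by (simp_all add: a_def)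
  ultimately show ?thesis
    by (intro that[of "nat a"]) (simp_all add: nat_less_iff)
qed

text \<open>Scaling by a power of \<open>p\<close> carries the decomposition of the unit ball into residue classes
  over to every ball.  Its centres are the residues \<open>0, \<dots>, p - 1\<close>, scaled.\<close>

lemma padic_ball_decomposition:
  fixes k :: int
  defines "c \<equiv> \<lambda>a. of_nat a * of_nat CARD('p) powi (- (k + 1)) :: 'p::prime_card padic"
  shows "padic_ball (k + 1) = (\<Union>a<CARD('p). (+) (c a) ` padic_ball k)"
    and "disjoint_family_on (\<lambda>a. (+) (c a) ` padic_ball k) {..<CARD('p)}"
proof -
  define u :: "'p padic" where "u = of_nat CARD('p) powi (- (k + 1))"
  have c: "c a = of_nat a * u" for a by (simp add: c_def u_def)
  have u: "padic_abs u = real CARD('p) powi (k + 1)"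
    unfolding u_def padic_abs_power_int padic_abs_CARD
    by (simp only: power_int_minus power_int_inverse inverse_inverse_eq)
  have u0: "u \<noteq> 0" using u padic_abs_eq_0_iff[of u] by (metis CARD_powi_pos less_irrefl)
  have mem: "x \<in> (+) (c a) ` padic_ball k \<longleftrightarrow> x - c a \<in> padic_ball k" for x a
    by (metis (no_types, lifting) add_diff_cancel_left' diff_add_cancel add.commute image_iff)
  have ball: "z * u \<in> padic_ball k \<longleftrightarrow> padic_abs z < 1" for z :: "'p padic"
  proof (cases "z = 0")
    case False
    then obtain l where l: "padic_abs z = real CARD('p) powi l"
      using padic_abs_value_group unfolding padic_sphere_def by blast
    have "z * u \<in> padic_ball k \<longleftrightarrow> real CARD('p) powi (l + (k + 1)) \<le> real CARD('p) powi k"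
      by (simp add: padic_ball_def padic_abs_mult u l power_int_add)
    also have "\<dots> \<longleftrightarrow> \<not> real CARD('p) powi 0 \<le> real CARD('p) powi l"
      unfolding CARD_powi_le_iff by auto
    finally show ?thesis using l by auto
  qed (simp add: padic_ball_def padic_abs_eq_0_iff[THEN iffD2] less_imp_le)
  show "padic_ball (k + 1) = (\<Union>a<CARD('p). (+) (c a) ` padic_ball k)"
  proof (intro equalityI subsetI)
    fix x :: "'p padic" assume x: "x \<in> padic_ball (k + 1)"
    have "padic_abs (x / u) * padic_abs u = padic_abs x"
      using u0 by (simp flip: padic_abs_mult)
    hence "padic_abs (x / u) * real CARD('p) powi (k + 1) \<le> 1 * real CARD('p) powi (k + 1)"
      using x by (simp add: u padic_ball_def)
    hence "padic_abs (x / u) \<le> 1" by (rule mult_right_le_imp_le) simp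
    then obtain a where a: "a < CARD('p)" "padic_abs (x / u - of_nat a) < 1"
      by (rule padic_residue)
    have "(x / u - of_nat a) * u = x - c a" using u0 by (simp add: c left_diff_distrib)
    with a(2) ball have "x - c a \<in> padic_ball k" by metis
    with a(1) mem show "x \<in> (\<Union>a<CARD('p). (+) (c a) ` padic_ball k)" by blast
  next
    fix x :: "'p padic" assume "x \<in> (\<Union>a<CARD('p). (+) (c a) ` padic_ball k)"
    then obtain a where a: "x - c a \<in> padic_ball k" using mem by blast
    hence a': "x - c a \<in> padic_ball (k + 1)"
      using CARD_powi_le_iff[of k "k + 1", where 'p='p] by (auto simp: padic_ball_def)
    have "padic_abs (of_nat a :: 'p padic) \<le> 1"
    proof (cases "a = 0")
      case False
      have "padic_abs_rat CARD('p) (of_nat a) = real CARD('p) powi (- int (multiplicity (int CARD('p)) (int a)))"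
        using False padic_abs_rat_frac[OF prime_card[where 'a='p], of "int a" 1] by simp
      also have "\<dots> \<le> real CARD('p) powi 0" unfolding CARD_powi_le_iff by simp
      finally show ?thesis using padic_abs_of_rat[of "of_nat a", where 'p='p] by simp
    qed (simp add: padic_abs_eq_0_iff[THEN iffD2])
    hence "c a \<in> padic_ball (k + 1)"
      by (simp add: padic_ball_def c padic_abs_mult u mult_left_le_one_le padic_abs_nonneg)
    with a' show "x \<in> padic_ball (k + 1)" using padic_ball_diff_iff by blast
  qed
  show "disjoint_family_on (\<lambda>a. (+) (c a) ` padic_ball k) {..<CARD('p)}"
  proof (unfold disjoint_family_on_def, intro ballI impI)
    fix a b assume ab: "a \<in> {..<CARD('p)}" "b \<in> {..<CARD('p)}" "a \<noteq> b"
    have False if "x - c a \<in> padic_ball k" "x - c b \<in> padic_ball k" for x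
    proof -
      have "(x - c a) - (x - c b) \<in> padic_ball k" using that padic_ball_diff_iff by blast
      moreover have "(x - c a) - (x - c b) = of_int (int b - int a) * u"
        by (simp add: c left_diff_distrib)
      ultimately have "int CARD('p) dvd int b - int a"
        by (metis ball padic_abs_of_int_lt_1_iff)
      with ab show False
        using zdvd_imp_le[of "int CARD('p)" "int b - int a"]
          zdvd_imp_le[of "int CARD('p)" "int a - int b"]
        by (auto simp: dvd_diff_commute not_less linorder_neq_iff)
    qed
    thus "(+) (c a) ` padic_ball k \<inter> (+) (c b) ` padic_ball k = {}" using mem by blast
  qed
qed

section \<open>Haar measure of balls and spheres\<close>

lemma padic_ball_eq_cball:
  "padic_ball k = cball (0 :: 'p::prime_card padic) (real CARD('p) powi k)"
  by (auto simp: padic_ball_def dist_padic_def padic_abs_minus)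

lemma padic_ball_translate_eq_cball:
  "(+) c ` padic_ball k = cball (c :: 'p::prime_card padic) (real CARD('p) powi k)"
proof (intro equalityI subsetI)
  fix x assume "x \<in> cball c (real CARD('p) powi k)"
  hence "x - c \<in> padic_ball k"
    by (simp add: padic_ball_def dist_padic_def padic_abs_diff_commute)
  thus "x \<in> (+) c ` padic_ball k" by (intro image_eqI[of _ _ "x - c"]) auto
qed (auto simp: padic_ball_def dist_padic_def padic_abs_minus)

lemma padic_ball_mono: "k \<le> l \<Longrightarrow> padic_ball k \<subseteq> (padic_ball l :: 'p::prime_card padic set)"
  using CARD_powi_le_iff[of k l, where 'p='p] by (auto simp: padic_ball_def)

lemma padic_ball_borel: "padic_ball k \<in> sets borel"
  by (simp add: padic_ball_eq_cball)

lemma padic_sphere_borel: "padic_sphere k \<in> sets borel"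
  unfolding padic_sphere_eq_ball_diff by (intro sets.Diff padic_ball_borel)

locale padic_haar_measure =
  fixes \<mu> :: "'p::prime_card padic measure"
  assumes haar: "padic_haar \<mu>"
begin

lemma sets_haar: "sets \<mu> = sets borel"
  using haar by (simp add: padic_haar_def)

lemma space_haar: "space \<mu> = UNIV"
  using sets_eq_imp_space_eq[OF sets_haar] by simp

text \<open>The \<open>p\<close> pieces of the ball are translates of one smaller ball, hence have equal measure.\<close>

lemma emeasure_padic_ball_Suc:
  "emeasure \<mu> (padic_ball (k + 1)) = of_nat CARD('p) * emeasure \<mu> (padic_ball k)"
proof -
  let ?c = "\<lambda>a. of_nat a * of_nat CARD('p) powi (- (k + 1)) :: 'p padic"
  have "emeasure \<mu> (padic_ball (k + 1)) = (\<Sum>a<CARD('p). emeasure \<mu> ((+) (?c a) ` padic_ball k))"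
    unfolding padic_ball_decomposition(1)
    using padic_ball_decomposition(2)
    by (intro sum_emeasure[symmetric]) (auto simp: sets_haar padic_ball_translate_eq_cball)
  also have "\<dots> = (\<Sum>a<CARD('p). emeasure \<mu> (padic_ball k))"
    using haar padic_ball_borel unfolding padic_haar_def by (intro sum.cong refl) blast
  finally show ?thesis by simp
qed

text \<open>The recursion is used in both directions, starting from the normalisation at
  \<open>k = 0\<close>.\<close>

lemma emeasure_padic_ball: "emeasure \<mu> (padic_ball k) = ennreal (real CARD('p) powi k)"
proof (induction k rule: int_induct[where k = 0])
  case base
  show ?case using haar by (simp add: padic_haar_def padic_ball_def)
next
  case (step1 k)
  have "emeasure \<mu> (padic_ball (k + 1)) = ennreal (real CARD('p)) * ennreal (real CARD('p) powi k)"
    by (simp only: emeasure_padic_ball_Suc step1 ennreal_of_nat_eq_real_of_nat)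
  thus ?case by (simp add: power_int_add_1' flip: ennreal_mult)
next
  case (step2 k)
  have p: "real CARD('p) > 0" by simp
  have "ennreal (real CARD('p) powi k) = ennreal (real CARD('p)) * emeasure \<mu> (padic_ball (k - 1))"
    using emeasure_padic_ball_Suc[of "k - 1"] step2 by (simp add: ennreal_of_nat_eq_real_of_nat)
  moreover have "real CARD('p) powi k = real CARD('p) * real CARD('p) powi (k - 1)"
    using p power_int_add_1'[of "real CARD('p)" "k - 1"] by simp
  ultimately have "ennreal (real CARD('p)) * emeasure \<mu> (padic_ball (k - 1)) =
      ennreal (real CARD('p)) * ennreal (real CARD('p) powi (k - 1))"
    by (simp only: ennreal_mult[symmetric] less_imp_le[OF p] less_imp_le[OF CARD_powi_pos])
  thus ?case using p by (simp only: ennreal_mult_cancel_left) simp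
qed

lemma emeasure_padic_sphere:
  "emeasure \<mu> (padic_sphere k) = ennreal ((1 - 1 / real CARD('p)) * real CARD('p) powi k)"
proof -
  have "emeasure \<mu> (padic_sphere k) = emeasure \<mu> (padic_ball k) - emeasure \<mu> (padic_ball (k - 1))"
    unfolding padic_sphere_eq_ball_diff
    by (intro emeasure_Diff)
      (simp_all add: emeasure_padic_ball sets_haar padic_ball_borel padic_ball_mono)
  also have "\<dots> = ennreal (real CARD('p) powi k - real CARD('p) powi (k - 1))"
    by (simp add: emeasure_padic_ball ennreal_minus)
  also have "real CARD('p) powi k - real CARD('p) powi (k - 1) =
      (1 - 1 / real CARD('p)) * real CARD('p) powi k"
    by (simp add: power_int_diff left_diff_distrib)
  finally show ?thesis .
qed

text \<open>The origin lies in balls of arbitrarily small measure.\<close>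

lemma null_sets_zero: "{0} \<in> null_sets \<mu>"
proof -
  have "emeasure \<mu> {0} \<le> ennreal ((1 / real CARD('p)) ^ n)" for n
  proof -
    have "emeasure \<mu> {0} \<le> emeasure \<mu> (padic_ball (- int n))"
      by (intro emeasure_mono) (auto simp: sets_haar padic_ball_borel padic_ball_eq_cball less_imp_le)
    thus ?thesis
      by (simp add: emeasure_padic_ball power_int_minus power_one_over inverse_eq_divide)
  qed
  moreover have "(\<lambda>n. ennreal ((1 / real CARD('p)) ^ n)) \<longlonglongrightarrow> ennreal 0"
    using CARD_gt_1[where 'p='p] by (intro tendsto_ennrealI LIMSEQ_realpow_zero) auto
  ultimately have "emeasure \<mu> {0} \<le> ennreal 0"
    by (intro LIMSEQ_le_const) auto
  thus ?thesis by (auto simp: sets_haar)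
qed

lemma AE_padic_sphere: "AE x in completion \<mu>. \<exists>k. x \<in> padic_sphere k"
proof (rule AE_completion, rule AE_I'[OF null_sets_zero])
  show "{x \<in> space \<mu>. \<not> (\<exists>k. x \<in> padic_sphere k)} \<subseteq> {0}"
    using padic_abs_value_group by blast
qed

lemma padic_sphere_sets [measurable]: "padic_sphere k \<in> sets (completion \<mu>)"
  by (intro sets_completionI_sets) (simp add: sets_haar padic_sphere_borel)

lemma padic_ball_sets [measurable]: "padic_ball k \<in> sets (completion \<mu>)"
  by (intro sets_completionI_sets) (simp add: sets_haar padic_ball_borel)

text \<open>Up to the null set \<open>{0}\<close> the spheres form a countable partition, so every integral is a
  sum over \<open>\<int>\<close>.\<close>

lemma nn_integral_padic_spheres:
  assumes [measurable]: "h \<in> borel_measurable (completion \<mu>)"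
  shows "(\<integral>\<^sup>+x. h x \<partial>completion \<mu>) =
    (\<integral>\<^sup>+k. (\<integral>\<^sup>+x\<in>padic_sphere k. h x \<partial>completion \<mu>) \<partial>count_space UNIV)"
proof -
  have "(\<integral>\<^sup>+k. h x * indicator (padic_sphere k) x \<partial>count_space UNIV) = h x"
    if x: "x \<in> padic_sphere l" for x l
  proof -
    have "indicator (padic_sphere k) x = (indicator {l} k :: ennreal)" for k
      using x by (auto simp: padic_sphere_def CARD_powi_eq_iff split: split_indicator)
    thus ?thesis by (simp add: nn_integral_cmult)
  qed
  hence "(\<integral>\<^sup>+x. h x \<partial>completion \<mu>) =
      (\<integral>\<^sup>+x. \<integral>\<^sup>+k. h x * indicator (padic_sphere k) x \<partial>count_space UNIV \<partial>completion \<mu>)"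
    using AE_padic_sphere by (intro nn_integral_cong_AE) auto
  also have "\<dots> = (\<integral>\<^sup>+k. (\<integral>\<^sup>+x\<in>padic_sphere k. h x \<partial>completion \<mu>) \<partial>count_space UNIV)"
    by (intro nn_integral_count_space_nn_integral) auto
  finally show ?thesis .
qed

lemma nn_integral_padic_ball:
  assumes [measurable]: "h \<in> borel_measurable (completion \<mu>)"
  shows "(\<integral>\<^sup>+x\<in>padic_ball k. h x \<partial>completion \<mu>) =
    (\<integral>\<^sup>+i. (\<integral>\<^sup>+x\<in>padic_sphere i. h x \<partial>completion \<mu>) * indicator {..k} i \<partial>count_space UNIV)"
proof -
  have "h x * indicator (padic_ball k) x * indicator (padic_sphere i) x =
      h x * indicator (padic_sphere i) x * indicator {..k} i" for i x
    by (auto simp: padic_sphere_def padic_ball_def CARD_powi_le_iff split: split_indicator)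
  thus ?thesis
    by (subst nn_integral_padic_spheres) (simp_all add: nn_integral_multc)
qed

lemma nn_integral_padic_sphere_const:
  assumes "\<And>x. x \<in> padic_sphere k \<Longrightarrow> h x = c"
  shows "(\<integral>\<^sup>+x\<in>padic_sphere k. h x \<partial>completion \<mu>) =
    c * ennreal ((1 - 1 / real CARD('p)) * real CARD('p) powi k)"
proof -
  have "(\<integral>\<^sup>+x\<in>padic_sphere k. h x \<partial>completion \<mu>) = (\<integral>\<^sup>+x\<in>padic_sphere k. c \<partial>completion \<mu>)"
    using assms by (intro nn_integral_cong) (auto split: split_indicator)
  also have "\<dots> = c * emeasure (completion \<mu>) (padic_sphere k)"
    by (simp add: nn_integral_cmult_indicator)
  finally show ?thesis
    by (simp add: emeasure_padic_sphere sets_haar padic_sphere_borel)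
qed

text \<open>The absolute value takes countably many values, each on a measurable set, so every function
  of it is measurable.  For a fixed first argument the kernel is of this kind, and so is
  the output of the operator.\<close>

lemma borel_measurable_radial:
  fixes g :: "'p padic \<Rightarrow> 'b::topological_space"
  assumes "\<And>x y. padic_abs x = padic_abs y \<Longrightarrow> g x = g y"
  shows "g \<in> borel_measurable (completion \<mu>)"
proof (rule measurableI)
  fix A :: "'b set"
  have zero: "{0} \<inter> g -` A \<in> sets (completion \<mu>)"
    by (rule null_sets_completion[OF null_sets_zero]) simp
  have "g -` A = ({0} \<inter> g -` A) \<union> (\<Union>k\<in>{k. padic_sphere k \<inter> g -` A \<noteq> {}}. padic_sphere k)"
    (is "_ = ?R")
  proof (intro equalityI subsetI)
    fix x assume x: "x \<in> g -` A"
    show "x \<in> ?R"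
    proof (cases "x = 0")
      case False
      then obtain k where "x \<in> padic_sphere k" by (rule padic_abs_value_group)
      thus ?thesis using x by blast
    qed (use x in simp)
  next
    fix x assume "x \<in> ?R"
    then consider "x \<in> g -` A"
      | k y where "x \<in> padic_sphere k" "y \<in> padic_sphere k" "y \<in> g -` A" by blast
    thus "x \<in> g -` A"
    proof cases
      case 2
      hence "g x = g y" by (intro assms) (simp add: padic_sphere_def)
      thus ?thesis using 2(3) by simp
    qed
  qed
  also have "\<dots> \<in> sets (completion \<mu>)"
    by (intro sets.Un zero sets.countable_UN') auto
  finally show "g -` A \<inter> space (completion \<mu>) \<in> sets (completion \<mu>)"
    by (simp add: space_haar)
qed simp

end


section \<open>The kernel operator as a convolution\<close>

text \<open>Up to constant factors, the Cesaro norm of \<open>g\<close> is the \<open>\<ell>\<^sup>r\<close>-norm of this sequence: the weight is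
  the value \<open>p powr (- k)\<close> of \<open>1 / padic_abs x\<close> on the \<open>k\<close>-th sphere times \<open>p powr (k / r)\<close>, which
  is the \<open>r\<close>-th root of the measure of that sphere.\<close>

definition ces_seq :: "'p::prime_card padic measure \<Rightarrow> real \<Rightarrow> ('p padic \<Rightarrow> ennreal) \<Rightarrow> int \<Rightarrow> ennreal" where
  "ces_seq M r g k =
    ennreal (real CARD('p) powr (- (real_of_int k * (1 - 1 / r)))) * (\<integral>\<^sup>+y\<in>padic_ball k. g y \<partial>M)"

text \<open>The operator applied to absolute values.  As an integral in \<open>[0, \<infinity>]\<close> it is defined before
  any convergence is known, and it dominates the original operator pointwise.  With \<open>K\<close> replaced by its
  absolute value this holds at \<open>x = 0\<close> as well, where \<open>K\<close> may be negative.\<close>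

definition nn_kernel_op ::
  "'p::prime_card padic measure \<Rightarrow> (real \<Rightarrow> real \<Rightarrow> real) \<Rightarrow> ('p padic \<Rightarrow> ennreal) \<Rightarrow> 'p padic \<Rightarrow> ennreal" where
  "nn_kernel_op M K g x = (\<integral>\<^sup>+y\<in>- {0}. ennreal \<bar>K (padic_abs x) (padic_abs y)\<bar> * g y \<partial>M)"

lemma ces_seq_mono:
  assumes "\<And>x. g x \<le> h x"
  shows "ces_seq M r g k \<le> ces_seq M r h k"
  unfolding ces_seq_def using assms by (intro mult_left_mono nn_integral_mono mult_right_mono) auto

context padic_haar_measure
begin

text \<open>The outer integrand is constant on each sphere, so the outer integral is a sum over \<open>k\<close> with
  weights \<open>(1 - 1 / p) * p powi k\<close>.  The power of \<open>p\<close> is absorbed into the \<open>r\<close>-th power, and the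
  constant factor stays outside.\<close>

lemma ces_norm_eq_ces_seq:
  assumes r: "0 < r"
  shows "ces_norm (completion \<mu>) r f = ennreal_powr (ennreal (1 - 1 / real CARD('p)) *
    (\<integral>\<^sup>+k. ennreal_powr (ces_seq (completion \<mu>) r (\<lambda>y. ennreal (norm (f y))) k) r \<partial>count_space UNIV)) (1 / r)"
proof -
  let ?p = "real CARD('p)" and ?q = "1 - 1 / real CARD('p)"
  let ?J = "\<lambda>k. \<integral>\<^sup>+y\<in>padic_ball k. ennreal (norm (f y)) \<partial>completion \<mu>"
  let ?F = "\<lambda>x. ennreal_powr (ennreal (1 / padic_abs x) *
    (\<integral>\<^sup>+y\<in>{y. padic_abs y \<le> padic_abs x}. ennreal (norm (f y)) \<partial>completion \<mu>)) r"
  have p: "?p > 1" by (rule CARD_gt_1)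
  hence q: "?q \<ge> 0" by simp
  have F_meas: "?F \<in> borel_measurable (completion \<mu>)"
    by (rule borel_measurable_radial) simp
  have "(\<integral>\<^sup>+x\<in>padic_sphere k. ?F x \<partial>completion \<mu>) =
      ennreal ?q * ennreal_powr (ces_seq (completion \<mu>) r (\<lambda>y. ennreal (norm (f y))) k) r" for k
  proof -
    have "(\<integral>\<^sup>+x\<in>padic_sphere k. ?F x \<partial>completion \<mu>) =
        ennreal_powr (ennreal (1 / ?p powi k) * ?J k) r * ennreal (?q * ?p powi k)"
      by (rule nn_integral_padic_sphere_const) (simp add: padic_sphere_def padic_ball_def)
    also have "\<dots> = ennreal ((1 / ?p powi k) powr r * (?q * ?p powi k)) * ennreal_powr (?J k) r"
      using q by (simp add: ennreal_powr_mult ennreal_powr_ennreal ennreal_mult mult_ac)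
    also have "(1 / ?p powi k) powr r * (?q * ?p powi k) =
        ?q * (?p powr (- (real_of_int k * (1 - 1 / r)))) powr r"
    proof -
      have powi: "?p powi k = ?p powr real_of_int k" using p by (simp add: powr_real_of_int')
      have "1 / ?p powi k = ?p powr (- real_of_int k)" by (simp only: powi powr_minus_divide)
      hence "(1 / ?p powi k) powr r * (?q * ?p powi k) = ?q * ?p powr (- real_of_int k * r + real_of_int k)"
        by (simp only: powi powr_powr powr_add mult_ac)
      also have "- real_of_int k * r + real_of_int k = - (real_of_int k * (1 - 1 / r)) * r"
        using r by (simp add: field_simps)
      finally show ?thesis by (simp only: powr_powr)
    qed
    also have "ennreal \<dots> * ennreal_powr (?J k) r =
        ennreal ?q * ennreal_powr (ces_seq (completion \<mu>) r (\<lambda>y. ennreal (norm (f y))) k) r"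
      using q by (simp add: ces_seq_def ennreal_powr_mult ennreal_powr_ennreal ennreal_mult mult_ac)
    finally show ?thesis .
  qed
  hence "(\<integral>\<^sup>+x. ?F x \<partial>completion \<mu>) = (\<integral>\<^sup>+k. ennreal ?q *
      ennreal_powr (ces_seq (completion \<mu>) r (\<lambda>y. ennreal (norm (f y))) k) r \<partial>count_space UNIV)"
    by (simp only: nn_integral_padic_spheres[OF F_meas])
  also have "\<dots> = ennreal ?q *
      (\<integral>\<^sup>+k. ennreal_powr (ces_seq (completion \<mu>) r (\<lambda>y. ennreal (norm (f y))) k) r \<partial>count_space UNIV)"
    by (rule nn_integral_cmult) simp
  finally show ?thesis unfolding ces_norm_def by (rule arg_cong)
qed

lemma zero_compl_sets [measurable]: "- {0} \<in> sets (completion \<mu>)"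
  by (intro sets_completionI_sets) (simp add: sets_haar)

lemma nn_kernel_op_radial: "padic_abs x = padic_abs y \<Longrightarrow> nn_kernel_op M K g x = nn_kernel_op M K g y"
  by (simp add: nn_kernel_op_def)

text \<open>Homogeneity turns the sum over the spheres \<open>j\<close> into a sum over the differences
  \<open>m = j - k\<close> in which the kernel no longer depends on \<open>k\<close>.\<close>

lemma nn_kernel_op_on_sphere:
  assumes [measurable]: "g \<in> borel_measurable (completion \<mu>)"
    and hom: "\<And>t x y. 0 < t \<Longrightarrow> 0 < x \<Longrightarrow> 0 < y \<Longrightarrow> K (t * x) (t * y) = inverse t * K x y"
    and x: "x \<in> padic_sphere k"
  shows "nn_kernel_op (completion \<mu>) K g x = ennreal (inverse (real CARD('p) powi k)) *
    (\<integral>\<^sup>+m. ennreal \<bar>K 1 (real CARD('p) powi m)\<bar> *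
      (\<integral>\<^sup>+y\<in>padic_sphere (k + m). g y \<partial>completion \<mu>) \<partial>count_space UNIV)"
proof -
  let ?p = "real CARD('p)"
  let ?a = "\<lambda>j. \<integral>\<^sup>+y\<in>padic_sphere j. g y \<partial>completion \<mu>"
  have [measurable]: "(\<lambda>y :: 'p padic. ennreal \<bar>K (padic_abs x) (padic_abs y)\<bar>) \<in> borel_measurable (completion \<mu>)"
    by (rule borel_measurable_radial) simp
  have "(\<integral>\<^sup>+y\<in>padic_sphere j. ennreal \<bar>K (padic_abs x) (padic_abs y)\<bar> * g y * indicator (- {0}) y \<partial>completion \<mu>) =
      ennreal \<bar>K (?p powi k) (?p powi j)\<bar> * ?a j" for j
  proof -
    have "(0 :: 'p padic) \<notin> padic_sphere j"
      using CARD_powi_pos[of j, where 'p='p] padic_abs_eq_0_iff[of "0::'p padic"] by (simp add: padic_sphere_def)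
    hence "(\<integral>\<^sup>+y\<in>padic_sphere j. ennreal \<bar>K (padic_abs x) (padic_abs y)\<bar> * g y * indicator (- {0}) y \<partial>completion \<mu>) =
        (\<integral>\<^sup>+y. ennreal \<bar>K (?p powi k) (?p powi j)\<bar> * (g y * indicator (padic_sphere j) y) \<partial>completion \<mu>)"
      using x by (intro nn_integral_cong) (auto simp: padic_sphere_def split: split_indicator)
    thus ?thesis by (simp add: nn_integral_cmult)
  qed
  hence "nn_kernel_op (completion \<mu>) K g x =
      (\<integral>\<^sup>+j. ennreal \<bar>K (?p powi k) (?p powi j)\<bar> * ?a j \<partial>count_space UNIV)"
    unfolding nn_kernel_op_def by (subst nn_integral_padic_spheres) simp_all
  also have "\<dots> = (\<integral>\<^sup>+m. ennreal \<bar>K (?p powi k) (?p powi (m + k))\<bar> * ?a (m + k) \<partial>count_space UNIV)"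
    by (rule nn_integral_count_space_shift[symmetric])
  also have "\<dots> = (\<integral>\<^sup>+m. ennreal (inverse (?p powi k)) * (ennreal \<bar>K 1 (?p powi m)\<bar> * ?a (k + m)) \<partial>count_space UNIV)"
  proof (intro nn_integral_cong)
    fix m :: int
    have "K (?p powi k) (?p powi (m + k)) = inverse (?p powi k) * K 1 (?p powi m)"
      using hom[of "?p powi k" 1 "?p powi m"] by (simp add: power_int_add mult_ac)
    hence "ennreal \<bar>K (?p powi k) (?p powi (m + k))\<bar> = ennreal (inverse (?p powi k)) * ennreal \<bar>K 1 (?p powi m)\<bar>"
      by (simp add: abs_mult less_imp_le flip: ennreal_mult)
    thus "ennreal \<bar>K (?p powi k) (?p powi (m + k))\<bar> * ?a (m + k) =
        ennreal (inverse (?p powi k)) * (ennreal \<bar>K 1 (?p powi m)\<bar> * ?a (k + m))"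
      by (simp add: mult_ac add.commute)
  qed
  finally show ?thesis by (simp add: nn_integral_cmult)
qed

text \<open>The factor \<open>inverse (p powi i)\<close> from homogeneity cancels the measure of the \<open>i\<close>-th sphere.
  What is left are the integrals of \<open>g\<close> over the spheres \<open>i + m\<close> with \<open>i \<le> k\<close>, which fill the ball
  of index \<open>k + m\<close>: the operator commutes with averaging over balls.\<close>

lemma nn_kernel_op_ball_integral:
  assumes [measurable]: "g \<in> borel_measurable (completion \<mu>)"
    and hom: "\<And>t x y. 0 < t \<Longrightarrow> 0 < x \<Longrightarrow> 0 < y \<Longrightarrow> K (t * x) (t * y) = inverse t * K x y"
  shows "(\<integral>\<^sup>+x\<in>padic_ball k. nn_kernel_op (completion \<mu>) K g x \<partial>completion \<mu>) =
    ennreal (1 - 1 / real CARD('p)) * (\<integral>\<^sup>+m. ennreal \<bar>K 1 (real CARD('p) powi m)\<bar> *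
      (\<integral>\<^sup>+y\<in>padic_ball (k + m). g y \<partial>completion \<mu>) \<partial>count_space UNIV)"
proof -
  let ?p = "real CARD('p)" and ?q = "1 - 1 / real CARD('p)"
  let ?a = "\<lambda>j. \<integral>\<^sup>+y\<in>padic_sphere j. g y \<partial>completion \<mu>"
  let ?T = "nn_kernel_op (completion \<mu>) K g"
  have q: "?q \<ge> 0" using CARD_gt_1[where 'p='p] by simp
  have T_meas: "?T \<in> borel_measurable (completion \<mu>)"
    by (rule borel_measurable_radial) (rule nn_kernel_op_radial)
  have sphere: "(\<integral>\<^sup>+x\<in>padic_sphere i. ?T x \<partial>completion \<mu>) =
      ennreal ?q * (\<integral>\<^sup>+m. ennreal \<bar>K 1 (?p powi m)\<bar> * ?a (i + m) \<partial>count_space UNIV)" (is "_ = _ * ?S i") for i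
  proof -
    have "(\<integral>\<^sup>+x\<in>padic_sphere i. ?T x \<partial>completion \<mu>) =
        ennreal (inverse (?p powi i)) * ?S i * ennreal (?q * ?p powi i)"
      by (intro nn_integral_padic_sphere_const nn_kernel_op_on_sphere hom assms)
    also have "\<dots> = ennreal (inverse (?p powi i) * (?q * ?p powi i)) * ?S i"
      using q by (simp add: ennreal_mult mult_ac less_imp_le)
    also have "inverse (?p powi i) * (?q * ?p powi i) = ?q"
      using CARD_powi_pos[of i, where 'p='p] by (simp add: field_simps)
    finally show ?thesis .
  qed
  have "?S i * indicator {..k} i = (\<integral>\<^sup>+m.
      ennreal \<bar>K 1 (?p powi m)\<bar> * (?a (i + m) * indicator {..k} i) \<partial>count_space UNIV)" for i
    by (simp add: mult.assoc flip: nn_integral_multc)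
  hence "(\<integral>\<^sup>+x\<in>padic_ball k. ?T x \<partial>completion \<mu>) =
      (\<integral>\<^sup>+i. ennreal ?q * (\<integral>\<^sup>+m. ennreal \<bar>K 1 (?p powi m)\<bar> * (?a (i + m) * indicator {..k} i)
        \<partial>count_space UNIV) \<partial>count_space UNIV)"
    by (simp only: nn_integral_padic_ball[OF T_meas] sphere mult.assoc)
  also have "\<dots> = ennreal ?q * (\<integral>\<^sup>+i. \<integral>\<^sup>+m. ennreal \<bar>K 1 (?p powi m)\<bar> *
      (?a (i + m) * indicator {..k} i) \<partial>count_space UNIV \<partial>count_space UNIV)"
    by (rule nn_integral_cmult) simp
  also have "(\<integral>\<^sup>+i. \<integral>\<^sup>+m. ennreal \<bar>K 1 (?p powi m)\<bar> * (?a (i + m) * indicator {..k} i)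
        \<partial>count_space UNIV \<partial>count_space UNIV) =
      (\<integral>\<^sup>+m. \<integral>\<^sup>+i. ennreal \<bar>K 1 (?p powi m)\<bar> * (?a (i + m) * indicator {..k} i)
        \<partial>count_space UNIV \<partial>count_space UNIV)"
    by (rule nn_integral_count_space_nn_integral) auto
  also have "\<dots> = (\<integral>\<^sup>+m. ennreal \<bar>K 1 (?p powi m)\<bar> *
      (\<integral>\<^sup>+y\<in>padic_ball (k + m). g y \<partial>completion \<mu>) \<partial>count_space UNIV)"
  proof (intro nn_integral_cong)
    fix m :: int
    have "(\<integral>\<^sup>+i. ?a (i + m) * indicator {..k} i \<partial>count_space UNIV) =
        (\<integral>\<^sup>+i. ?a (i + m) * indicator {..k + m} (i + m) \<partial>count_space UNIV)"
      by (intro nn_integral_cong) (simp split: split_indicator)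
    also have "\<dots> = (\<integral>\<^sup>+y\<in>padic_ball (k + m). g y \<partial>completion \<mu>)"
      by (subst nn_integral_count_space_shift[of "\<lambda>i. ?a i * indicator {..k + m} i"])
        (simp add: nn_integral_padic_ball)
    finally show "(\<integral>\<^sup>+i. ennreal \<bar>K 1 (?p powi m)\<bar> * (?a (i + m) * indicator {..k} i) \<partial>count_space UNIV) =
        ennreal \<bar>K 1 (?p powi m)\<bar> * (\<integral>\<^sup>+y\<in>padic_ball (k + m). g y \<partial>completion \<mu>)"
      by (simp add: nn_integral_cmult)
  qed
  finally show ?thesis .
qed

text \<open>On Cesaro sequences the operator is a convolution on \<open>\<int>\<close>, since the weight
  of the index \<open>k\<close> is the weight of \<open>k + m\<close> times a factor that depends on \<open>m\<close> only.  For nonnegative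
  \<open>K\<close> the convolution kernel sums to \<open>kernel_const\<close>.\<close>

lemma ces_seq_nn_kernel_op:
  assumes "g \<in> borel_measurable (completion \<mu>)"
    and "\<And>t x y. 0 < t \<Longrightarrow> 0 < x \<Longrightarrow> 0 < y \<Longrightarrow> K (t * x) (t * y) = inverse t * K x y"
  shows "ces_seq (completion \<mu>) r (nn_kernel_op (completion \<mu>) K g) k =
    (\<integral>\<^sup>+m. ennreal (1 - 1 / real CARD('p)) *
        ennreal (\<bar>K 1 (real CARD('p) powi m)\<bar> * real CARD('p) powr (real_of_int m * (1 - 1 / r))) *
      ces_seq (completion \<mu>) r g (k + m) \<partial>count_space UNIV)"
proof -
  let ?p = "real CARD('p)" and ?q = "1 - 1 / real CARD('p)"
  let ?J = "\<lambda>k. \<integral>\<^sup>+y\<in>padic_ball k. g y \<partial>completion \<mu>"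
  have "ces_seq (completion \<mu>) r (nn_kernel_op (completion \<mu>) K g) k =
      (\<integral>\<^sup>+m. ennreal (?p powr (- (real_of_int k * (1 - 1 / r)))) *
        (ennreal ?q * (ennreal \<bar>K 1 (?p powi m)\<bar> * ?J (k + m))) \<partial>count_space UNIV)"
    by (simp add: ces_seq_def nn_kernel_op_ball_integral[OF assms(1), of K, OF assms(2)] nn_integral_cmult)
  also have "\<dots> = (\<integral>\<^sup>+m. ennreal ?q * ennreal (\<bar>K 1 (?p powi m)\<bar> * ?p powr (real_of_int m * (1 - 1 / r))) *
      ces_seq (completion \<mu>) r g (k + m) \<partial>count_space UNIV)"
  proof (intro nn_integral_cong)
    fix m :: int
    have "ennreal (?p powr (- (real_of_int k * (1 - 1 / r)))) =
        ennreal (?p powr (real_of_int m * (1 - 1 / r))) * ennreal (?p powr (- (real_of_int (k + m) * (1 - 1 / r))))"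
      by (simp add: algebra_simps flip: ennreal_mult powr_add)
    thus "ennreal (?p powr (- (real_of_int k * (1 - 1 / r)))) *
        (ennreal ?q * (ennreal \<bar>K 1 (?p powi m)\<bar> * ?J (k + m))) =
      ennreal ?q * ennreal (\<bar>K 1 (?p powi m)\<bar> * ?p powr (real_of_int m * (1 - 1 / r))) *
        ces_seq (completion \<mu>) r g (k + m)"
      by (simp add: ces_seq_def ennreal_mult mult_ac)
  qed
  finally show ?thesis .
qed

text \<open>Each term of a convergent sum is finite, and the integral over a ball controls the value on
  the outermost sphere.\<close>

lemma radial_finite_if_ces_seq_finite:
  assumes radial: "\<And>x y. padic_abs x = padic_abs y \<Longrightarrow> g x = g y"
    and fin: "(\<integral>\<^sup>+k. ennreal_powr (ces_seq (completion \<mu>) r g k) r \<partial>count_space UNIV) < \<infinity>"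
    and x: "x \<noteq> 0"
  shows "g x < \<infinity>"
proof -
  let ?p = "real CARD('p)" and ?q = "1 - 1 / real CARD('p)"
  obtain k where k: "x \<in> padic_sphere k" using x by (rule padic_abs_value_group)
  have "ennreal_powr (ces_seq (completion \<mu>) r g k) r \<le>
      (\<integral>\<^sup>+k. ennreal_powr (ces_seq (completion \<mu>) r g k) r \<partial>count_space UNIV)"
    by (rule nn_integral_ge_point) simp
  hence "ces_seq (completion \<mu>) r g k < \<infinity>"
    using fin by (metis ennreal_powr_less_top_iff le_less_trans)
  moreover have "?p powr (- (real_of_int k * (1 - 1 / r))) > 0"
    using CARD_gt_1[where 'p='p] by simp
  ultimately have ball: "(\<integral>\<^sup>+y\<in>padic_ball k. g y \<partial>completion \<mu>) < \<infinity>"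
    by (auto simp: ces_seq_def ennreal_mult_less_top)
  have "g x * ennreal (?q * ?p powi k) = (\<integral>\<^sup>+y\<in>padic_sphere k. g y \<partial>completion \<mu>)"
    using k by (intro nn_integral_padic_sphere_const[symmetric] radial) (simp add: padic_sphere_def)
  also have "\<dots> \<le> (\<integral>\<^sup>+y\<in>padic_ball k. g y \<partial>completion \<mu>)"
    by (intro nn_integral_mono) (auto simp: padic_sphere_def padic_ball_def split: split_indicator)
  finally have "g x * ennreal (?q * ?p powi k) < \<infinity>" using ball by (rule le_less_trans)
  moreover have "?q * ?p powi k > 0"
    using CARD_gt_1[where 'p='p] by (intro mult_pos_pos) auto
  ultimately show ?thesis by (auto simp: ennreal_mult_less_top)
qed

lemma borel_measurable_kernel_integrand:
  assumes [measurable]: "f \<in> borel_measurable (completion \<mu>)"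
  shows "kernel_integrand K f x \<in> borel_measurable (completion \<mu>)"
proof -
  have [measurable]: "(\<lambda>y :: 'p padic. complex_of_real (K (padic_abs x) (padic_abs y)))
      \<in> borel_measurable (completion \<mu>)"
    by (rule borel_measurable_radial) simp
  show ?thesis unfolding kernel_integrand_def[abs_def] by measurable
qed

lemma nn_integral_norm_kernel_integrand:
  "(\<integral>\<^sup>+y. ennreal (norm (indicator (- {0}) y *\<^sub>R kernel_integrand K f x y)) \<partial>completion \<mu>) =
    nn_kernel_op (completion \<mu>) K (\<lambda>y. ennreal (norm (f y))) x"
  unfolding nn_kernel_op_def kernel_integrand_def
  by (intro nn_integral_cong) (auto simp: norm_mult ennreal_mult split: split_indicator)

lemma set_integrable_kernel_integrand:
  assumes f: "f \<in> borel_measurable (completion \<mu>)"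
    and fin: "nn_kernel_op (completion \<mu>) K (\<lambda>y. ennreal (norm (f y))) x < \<infinity>"
  shows "set_integrable (completion \<mu>) (- {0}) (kernel_integrand K f x)"
  unfolding set_integrable_def
proof (rule integrableI_bounded)
  show "(\<lambda>y. indicator (- {0}) y *\<^sub>R kernel_integrand K f x y) \<in> borel_measurable (completion \<mu>)"
    using borel_measurable_kernel_integrand[OF f] by measurable
qed (use fin in \<open>simp only: nn_integral_norm_kernel_integrand\<close>)

lemma norm_kernel_op_le:
  "ennreal (norm (kernel_op (completion \<mu>) K f x)) \<le>
    nn_kernel_op (completion \<mu>) K (\<lambda>y. ennreal (norm (f y))) x"
proof (cases "integrable (completion \<mu>) (\<lambda>y. indicator (- {0}) y *\<^sub>R kernel_integrand K f x y)")
  case True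
  thus ?thesis
    using integral_norm_bound_ennreal[OF True]
    by (simp only: nn_integral_norm_kernel_integrand kernel_op_def set_lebesgue_integral_def)
next
  case False
  thus ?thesis
    by (simp add: kernel_op_def set_lebesgue_integral_def not_integrable_integral_eq)
qed

end


section \<open>Boundedness on Cesaro spaces\<close>

theorem theorem4p1:
  fixes \<mu> :: "'p::prime_card padic measure"
    and r :: real
    and K :: "real \<Rightarrow> real \<Rightarrow> real"
    and f :: "'p padic \<Rightarrow> complex"
  assumes "padic_haar \<mu>"
    and "1 < r"
    and "(\<lambda>(x, y). K x y) \<in> borel_measurable (lebesgue_on ({0<..} \<times> {0<..}))"
    and "\<And>x y. 0 < x \<Longrightarrow> 0 < y \<Longrightarrow> 0 \<le> K x y"
    and "\<And>t x y. 0 < t \<Longrightarrow> 0 < x \<Longrightarrow> 0 < y \<Longrightarrow> K (t * x) (t * y) = inverse t * K x y"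
    and "kernel_const CARD('p) K r < \<infinity>"
    and "f \<in> ces_space (completion \<mu>) r"
  shows "(\<forall>x. x \<noteq> 0 \<longrightarrow> set_integrable (completion \<mu>) (- {0}) (kernel_integrand K f x)) \<and>
    kernel_op (completion \<mu>) K f \<in> ces_space (completion \<mu>) r \<and>
    ces_norm (completion \<mu>) r (kernel_op (completion \<mu>) K f)
      \<le> kernel_const CARD('p) K r * ces_norm (completion \<mu>) r f"
proof -
  interpret padic_haar_measure \<mu> by unfold_locales (rule assms(1))
  note r = assms(2)
  let ?M = "completion \<mu>" and ?p = "real CARD('p)" and ?q = "1 - 1 / real CARD('p)"
  let ?g = "\<lambda>y. ennreal (norm (f y))"
  let ?T = "nn_kernel_op ?M K ?g"
  let ?C = "kernel_const CARD('p) K r"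
  let ?S = "\<lambda>g. \<integral>\<^sup>+k. ennreal_powr (ces_seq ?M r g k) r \<partial>count_space UNIV"
  define c where "c m = ennreal ?q *
    ennreal (\<bar>K 1 (?p powi m)\<bar> * ?p powr (real_of_int m * (1 - 1 / r)))" for m
  have f: "f \<in> borel_measurable ?M" and f_norm: "ces_norm ?M r f < \<infinity>"
    using assms(7) by (simp_all add: ces_space_def)
  have g: "?g \<in> borel_measurable ?M" using f by measurable
  have "\<bar>K 1 (?p powi m)\<bar> = K 1 (?p powi m)" for m
    by (rule abs_of_nonneg) (rule assms(4); simp)
  hence sum_c: "(\<integral>\<^sup>+m. c m \<partial>count_space UNIV) = ?C"
    by (simp add: c_def kernel_const_def nn_integral_cmult nn_integral_count_space_eq_infsum)
  have norm_eq: "ces_norm ?M r u = ennreal_powr (ennreal ?q * ?S (\<lambda>y. ennreal (norm (u y)))) (1 / r)"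
    for u :: "'p padic \<Rightarrow> complex"
    using r by (intro ces_norm_eq_ces_seq) simp
  \<comment> \<open>this is the norm bound, up to the constant \<open>?q\<close> and the root\<close>
  have young: "?S ?T \<le> ennreal_powr ?C r * ?S ?g"
    using Young_convolution_int[of r c "ces_seq ?M r ?g"] r assms(6)
    by (simp add: ces_seq_nn_kernel_op[OF g, of K, OF assms(5)] sum_c flip: c_def)
  have "ennreal_powr (ennreal ?q * ?S ?T) (1 / r) \<le>
      ennreal_powr (ennreal_powr ?C r * (ennreal ?q * ?S ?g)) (1 / r)"
    using r mult_left_mono[OF young, of "ennreal ?q"]
    by (intro ennreal_powr_mono) (simp_all add: mult_ac)
  also have "\<dots> = ?C * ces_norm ?M r f"
    using r by (simp add: norm_eq ennreal_powr_mult ennreal_powr_powr)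
  finally have T_norm: "ennreal_powr (ennreal ?q * ?S ?T) (1 / r) \<le> ?C * ces_norm ?M r f" .
  also have "\<dots> < \<infinity>" using assms(6) f_norm by (simp add: ennreal_mult_less_top)
  \<comment> \<open>the bound is finite, which makes the integral defining the operator converge absolutely\<close>
  finally have "ennreal ?q * ?S ?T < \<infinity>" by (simp only: ennreal_powr_less_top_iff)
  hence fin: "?S ?T < \<infinity>"
    using CARD_gt_1[where 'p='p] by (auto simp: ennreal_mult_less_top)
  have integrable: "set_integrable ?M (- {0}) (kernel_integrand K f x)" if "x \<noteq> 0" for x
    using radial_finite_if_ces_seq_finite[OF nn_kernel_op_radial fin that]
    by (intro set_integrable_kernel_integrand f)
  have "?S (\<lambda>y. ennreal (norm (kernel_op ?M K f y))) \<le> ?S ?T"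
    using r by (intro nn_integral_mono ennreal_powr_mono ces_seq_mono norm_kernel_op_le) auto
  hence "ces_norm ?M r (kernel_op ?M K f) \<le> ennreal_powr (ennreal ?q * ?S ?T) (1 / r)"
    unfolding norm_eq using r by (intro ennreal_powr_mono mult_left_mono) auto
  hence bound: "ces_norm ?M r (kernel_op ?M K f) \<le> ?C * ces_norm ?M r f"
    using T_norm by (rule order_trans)
  have "kernel_op ?M K f \<in> borel_measurable ?M"
    by (rule borel_measurable_radial)
      (simp add: kernel_op_def kernel_integrand_def[abs_def])
  moreover have "ces_norm ?M r (kernel_op ?M K f) < \<infinity>"
    using bound assms(6) f_norm by (simp add: ennreal_mult_less_top le_less_trans)
  ultimately show ?thesis
    using integrable bound by (simp add: ces_space_def)
qed

end
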